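(* Let $(X,d)$ be a compact metric space and let $f\colon X\to X$ be a continuous map satisfying the following properties: (1) $f$ is chain transitive; (2) $f$ has the shadowing property along $\mathcal{D}$; (3) the map $\mathcal{D}(\cdot)\colon (X,d)\to (K(X),d_H)$ is continuous; (4) $h_{top}(f)>0$, where $h_{top}$ denotes topological entropy. Then for every integer $n\ge 2$ there exists $\delta_n>0$ such that for every $D\in\mathcal{D}$, the set $D^n\cap \mathrm{DC1}_n^{\delta_n}(X,f)$ is a residual subset of $D^n$, i.e., contains a dense $G_\delta$-set of $D^n$.
   Context: Let $(X,d)$ be a compact metric space and $f\colon X\to X$ a continuous map. Chains. For $\delta>0$, a finite sequence $(x_i)_{i=0}^k$ in $X$ ($k$ a positive integer) is a $\delta$-chain of $f$ if $d(f(x_i),x_{i+1})\le\delta$ for every $0\le i\le k-1$. $f$ is chain transitive if for all $x,y\in X$ and $\delta>0$ there is a $\delta$-chain $(x_i)_{i=0}^k$ of $f$ with $x_0=x$ and $x_k=y$. The relation $\sim$ (for $f$ chain transitive). A $\delta$-chain $(x_i)_{i=0}^k$ with $x_0=x_k$ is a $\delta$-cycle of length $k$. Let $m=m(\delta)>0$ be the greatest common divisor of the lengths of all $\delta$-cycles of $f$. Define $x\sim_\delta y$ iff there is a $\delta$-chain $(x_i)_{i=0}^k$ of $f$ with $x_0=x$, $x_k=y$ and $m\mid k$; this is an equivalence relation on $X$ which is open and closed in $X^2$. Define $x\sim y$ iff $x\sim_\delta y$ for every $\delta>0$; this is a closed equivalence relation on $X$. $\mathcal{D}$ denotes the set of equivalence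 classes of $\sim$ (each is a closed subset of $X$), and $\mathcal{D}(x)\in\mathcal{D}$ denotes the class containing $x$. $K(X)$ is the set of non-empty closed subsets of $X$ with the Hausdorff metric $d_H(A,B)=\inf\{\epsilon>0\colon A\subset B_\epsilon(B),\ B\subset B_\epsilon(A)\}$, where $B_\epsilon(A)=\{x\in X\colon d(x,A)<\epsilon\}$. Shadowing along $\mathcal{D}$. For $\delta>0$, a sequence $(x_i)_{i\ge0}$ in $X$ is a $(\mathcal{D},\delta)$-pseudo orbit of $f$ if $f(x_i)\sim x_{i+1}$ and $d(f(x_i),x_{i+1})\le\delta$ for all $i\ge0$. $f$ has the shadowing property along $\mathcal{D}$ if for every $\epsilon>0$ there is $\delta>0$ such that for every $(\mathcal{D},\delta)$-pseudo orbit $(x_i)_{i\ge0}$ of $f$ there is $x\in X$ with $x_0\sim x$ and $d(f^i(x),x_i)\le\epsilon$ for all $i\ge0$. Distributional scrambling. For $n\ge2$ and $\delta>0$, $\mathrm{DC1}_n^\delta(X,f)$ is the set of $(x_1,\dots,x_n)\in X^n$ such that $$\limsup_{m\to\infty}\frac1m\left|\{0\le k\le m-1\colon \max_{1\le i<j\le n}d(f^k(x_i),f^k(x_j))<\epsilon\}\right|=1\quad\text{for all }\epsilon>0,$$ and $$\limsup_{m\to\infty}\frac1m\left|\{0\le k\le m-1\colon \min_{1\le i<j\le n}d(f^k(x_i),f^k(x_j))>\delta\}\right|=1.$$ $D^n$ carries the product (subspace) topology. *)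

theory Defs
  imports "HOL-Analysis.Analysis"
begin

text \<open>Finite sequences \<open>(x\<^sub>0, \<dots>, x\<^sub>k)\<close> are functions on \<^typ>\<open>nat\<close> whose values beyond \<open>k\<close> are ignored.\<close>

definition delta_chain :: "('a::metric_space \<Rightarrow> 'a) \<Rightarrow> real \<Rightarrow> nat \<Rightarrow> (nat \<Rightarrow> 'a) \<Rightarrow> bool" where
  "delta_chain f \<delta> k x \<longleftrightarrow> 0 < k \<and> (\<forall>i<k. dist (f (x i)) (x (Suc i)) \<le> \<delta>)"

definition chain_transitive :: "('a::metric_space \<Rightarrow> 'a) \<Rightarrow> bool" where
  "chain_transitive f \<longleftrightarrow>
     (\<forall>x y. \<forall>\<delta>>0. \<exists>k c. delta_chain f \<delta> k c \<and> c 0 = x \<and> c k = y)"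

definition cycle_gcd :: "('a::metric_space \<Rightarrow> 'a) \<Rightarrow> real \<Rightarrow> nat" where
  "cycle_gcd f \<delta> = Gcd {k. \<exists>c. delta_chain f \<delta> k c \<and> c 0 = c k}"

definition chain_rel_delta :: "('a::metric_space \<Rightarrow> 'a) \<Rightarrow> real \<Rightarrow> ('a \<times> 'a) set" where
  "chain_rel_delta f \<delta> =
     {(x, y). \<exists>k c. delta_chain f \<delta> k c \<and> c 0 = x \<and> c k = y \<and> cycle_gcd f \<delta> dvd k}"

definition chain_rel :: "('a::metric_space \<Rightarrow> 'a) \<Rightarrow> ('a \<times> 'a) set" where
  "chain_rel f = {(x, y). \<forall>\<delta>>0. (x, y) \<in> chain_rel_delta f \<delta>}"

definition chain_classes :: "('a::metric_space \<Rightarrow> 'a) \<Rightarrow> 'a set set" where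
  "chain_classes f = UNIV // chain_rel f"

definition chain_class :: "('a::metric_space \<Rightarrow> 'a) \<Rightarrow> 'a \<Rightarrow> 'a set" where
  "chain_class f x = chain_rel f `` {x}"

definition class_pseudo_orbit :: "('a::metric_space \<Rightarrow> 'a) \<Rightarrow> real \<Rightarrow> (nat \<Rightarrow> 'a) \<Rightarrow> bool" where
  "class_pseudo_orbit f \<delta> x \<longleftrightarrow>
     (\<forall>i. (f (x i), x (Suc i)) \<in> chain_rel f \<and> dist (f (x i)) (x (Suc i)) \<le> \<delta>)"

definition shadowing_along_classes :: "('a::metric_space \<Rightarrow> 'a) \<Rightarrow> bool" where
  "shadowing_along_classes f \<longleftrightarrow>
     (\<forall>\<epsilon>>0. \<exists>\<delta>>0. \<forall>x. class_pseudo_orbit f \<delta> x \<longrightarrow>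
        (\<exists>y. (x 0, y) \<in> chain_rel f \<and> (\<forall>i. dist ((f ^^ i) y) (x i) \<le> \<epsilon>)))"

definition hyperspace :: "'a::metric_space set set" where
  "hyperspace = {A. A \<noteq> {} \<and> closed A}"

text \<open>Since \<^term>\<open>infdist x {} = 0\<close>, the next two notions are meaningful for non-empty sets only.\<close>

definition nbhd :: "real \<Rightarrow> 'a::metric_space set \<Rightarrow> 'a set" where
  "nbhd \<epsilon> A = {x. infdist x A < \<epsilon>}"

definition hausdorff_dist :: "'a::metric_space set \<Rightarrow> 'a set \<Rightarrow> real" where
  "hausdorff_dist A B = Inf {\<epsilon>. \<epsilon> > 0 \<and> A \<subseteq> nbhd \<epsilon> B \<and> B \<subseteq> nbhd \<epsilon> A}"

lemma Metric_space_hausdorff: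
  assumes "compact (UNIV :: 'a::metric_space set)"
  shows "Metric_space (hyperspace :: 'a set set) hausdorff_dist"
proof -
  let ?S = "\<lambda>A B :: 'a set. {\<epsilon>. \<epsilon> > 0 \<and> A \<subseteq> nbhd \<epsilon> B \<and> B \<subseteq> nbhd \<epsilon> A}"
  obtain C where C: "C > 0" "\<And>x y :: 'a. dist x y < C"
  proof -
    obtain e where e: "\<And>x y :: 'a. dist x y \<le> e"
      using compact_imp_bounded[OF assms] bounded_two_points[of "UNIV :: 'a set"] by auto
    show ?thesis
      by (rule that[of "\<bar>e\<bar> + 1"]) (auto intro: order.strict_trans1[OF e])
  qed
  have near: "infdist x A < C" for x and A :: "'a set"
  proof (cases "A = {}")
    case False
    then obtain a where "a \<in> A" by blast
    then show ?thesis using infdist_le C(2)[of x a] order.strict_trans1 by blast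
  qed (use C in \<open>simp add: infdist_def\<close>)
  have ne: "?S A B \<noteq> {}" for A B
    using near C(1) by (auto simp: nbhd_def)
  have bdd: "bdd_below (?S A B)" for A B
    by (rule bdd_belowI[of _ 0]) auto
  have approx: "\<exists>e \<in> ?S A B. e < hausdorff_dist A B + r" if "r > 0" for A B r
    using cInf_lessD[OF ne, of A B "hausdorff_dist A B + r"] that
    by (auto simp: hausdorff_dist_def)
  have mono: "nbhd d A \<subseteq> nbhd e A" if "d \<le> e" for d e and A :: "'a set"
    using that by (auto simp: nbhd_def)
  have self: "hausdorff_dist A A = 0" for A :: "'a set"
  proof (rule antisym)
    show "hausdorff_dist A A \<le> 0"
    proof (rule field_le_epsilon)
      fix e :: real assume "e > 0"
      then show "hausdorff_dist A A \<le> 0 + e"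
        unfolding hausdorff_dist_def by (intro cInf_lower[OF _ bdd]) (auto simp: nbhd_def)
    qed
    show "0 \<le> hausdorff_dist A A"
      unfolding hausdorff_dist_def by (rule cInf_greatest[OF ne]) auto
  qed
  have sub: "A \<subseteq> B" if "hausdorff_dist A B = 0 \<or> hausdorff_dist B A = 0" "B \<in> hyperspace" for A B :: "'a set"
  proof
    fix x assume x: "x \<in> A"
    have "infdist x B < r" if "r > 0" for r
      using approx[OF that, of A B] approx[OF that, of B A] x
        \<open>hausdorff_dist A B = 0 \<or> hausdorff_dist B A = 0\<close>
      by (fastforce simp: nbhd_def)
    then have "infdist x B = 0"
      using infdist_nonneg[of x B] by (meson less_irrefl not_le order.antisym)
    then show "x \<in> B"
      using that(2) by (simp add: hyperspace_def in_closed_iff_infdist_zero)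
  qed
  have step: "A \<subseteq> nbhd (d + e) D" if "A \<subseteq> nbhd d B" "B \<subseteq> nbhd e D" "B \<noteq> {}" "D \<noteq> {}"
    for A B D :: "'a set" and d e
  proof
    fix x assume "x \<in> A"
    then have "infdist x B < d" using that by (auto simp: nbhd_def)
    then obtain b where b: "b \<in> B" "dist x b < d"
      using \<open>B \<noteq> {}\<close> by (auto simp: infdist_def cInf_less_iff)
    then have "infdist b D < e" using that by (auto simp: nbhd_def)
    then have "infdist x D < d + e"
      using infdist_triangle[of x D b] b by linarith
    then show "x \<in> nbhd (d + e) D" by (simp add: nbhd_def)
  qed
  show ?thesis
  proof
    show "0 \<le> hausdorff_dist A B" for A B :: "'a set"
      unfolding hausdorff_dist_def by (rule cInf_greatest[OF ne]) auto
    show "hausdorff_dist A B = hausdorff_dist B A" for A B :: "'a set"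
      unfolding hausdorff_dist_def by (simp add: conj_commute)
    show "(hausdorff_dist A B = 0) = (A = B)" if "A \<in> hyperspace" "B \<in> hyperspace" for A B :: "'a set"
      using sub[of A B] sub[of B A] that self by blast
    show "hausdorff_dist A D \<le> hausdorff_dist A B + hausdorff_dist B D"
      if h: "A \<in> hyperspace" "B \<in> hyperspace" "D \<in> hyperspace" for A B D :: "'a set"
    proof (rule field_le_epsilon)
      fix r :: real assume "r > 0"
      then have "r / 2 > 0" by simp
      obtain d where d: "d \<in> ?S A B" "d < hausdorff_dist A B + r / 2"
        using approx[OF \<open>r / 2 > 0\<close>] by blast
      obtain e where e: "e \<in> ?S B D" "e < hausdorff_dist B D + r / 2"
        using approx[OF \<open>r / 2 > 0\<close>] by blast
      have "d + e \<in> ?S A D"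
        using step[of A d B e D] step[of D e B d A] d(1) e(1) h
        by (auto simp: hyperspace_def add.commute)
      then have "hausdorff_dist A D \<le> d + e"
        unfolding hausdorff_dist_def by (rule cInf_lower[OF _ bdd])
      then show "hausdorff_dist A D \<le> hausdorff_dist A B + hausdorff_dist B D + r"
        using d e by linarith
    qed
  qed
qed

text \<open>The Bowen--Dinaburg definition by \<open>(n, \<epsilon>)\<close>-separated sets:
  \<open>h\<^sub>t\<^sub>o\<^sub>p(f) = lim\<^bsub>\<epsilon>\<rightarrow>0\<^esub> limsup\<^bsub>n\<rightarrow>\<infinity>\<^esub> (1/n) log s\<^sub>n(\<epsilon>)\<close>, where \<open>s\<^sub>n(\<epsilon>)\<close> is the greatest cardinality of a
  set that is \<open>\<epsilon>\<close>-separated for the metric \<open>max\<^bsub>i<n\<^esub> d(f\<^sup>i x, f\<^sup>i y)\<close>. For continuous \<open>f\<close> on a compact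
  space these cardinalities are bounded, so the supremum in \<open>separated_number\<close> is a maximum;
  the limit \<open>\<epsilon> \<rightarrow> 0\<close> is a supremum by monotonicity.\<close>

definition separated :: "('a::metric_space \<Rightarrow> 'a) \<Rightarrow> nat \<Rightarrow> real \<Rightarrow> 'a set \<Rightarrow> bool" where
  "separated f n \<epsilon> E \<longleftrightarrow>
     (\<forall>x\<in>E. \<forall>y\<in>E. x \<noteq> y \<longrightarrow> (\<exists>i<n. dist ((f ^^ i) x) ((f ^^ i) y) > \<epsilon>))"

definition separated_number :: "('a::metric_space \<Rightarrow> 'a) \<Rightarrow> nat \<Rightarrow> real \<Rightarrow> nat" where
  "separated_number f n \<epsilon> = Sup {card E | E. finite E \<and> separated f n \<epsilon> E}"

definition topological_entropy :: "('a::metric_space \<Rightarrow> 'a) \<Rightarrow> ereal" where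
  "topological_entropy f =
     (SUP \<epsilon>\<in>{0<..}. limsup (\<lambda>n. ereal (ln (real (separated_number f n \<epsilon>)) / real n)))"

definition upper_density :: "nat set \<Rightarrow> ereal" where
  "upper_density A = limsup (\<lambda>m. ereal (real (card {k. k < m \<and> k \<in> A}) / real m))"

definition pair_dists :: "('a::metric_space \<Rightarrow> 'a) \<Rightarrow> nat \<Rightarrow> (nat \<Rightarrow> 'a) \<Rightarrow> nat \<Rightarrow> real set" where
  "pair_dists f n x k =
     {dist ((f ^^ k) (x i)) ((f ^^ k) (x j)) | i j. 1 \<le> i \<and> i < j \<and> j \<le> n}"

text \<open>Points of \<open>X\<^sup>n\<close> are extensional functions on \<open>{1..n}\<close>.\<close>

definition DC1 :: "nat \<Rightarrow> real \<Rightarrow> ('a::metric_space \<Rightarrow> 'a) \<Rightarrow> (nat \<Rightarrow> 'a) set" where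
  "DC1 n \<delta> f = {x \<in> {1..n} \<rightarrow>\<^sub>E UNIV.
     (\<forall>\<epsilon>>0. upper_density {k. Max (pair_dists f n x k) < \<epsilon>} = 1) \<and>
     upper_density {k. Min (pair_dists f n x k) > \<delta>} = 1}"

definition residual_in :: "'a topology \<Rightarrow> 'a set \<Rightarrow> bool" where
  "residual_in T S \<longleftrightarrow> S \<subseteq> topspace T \<and>
     (\<exists>G. gdelta_in T G \<and> T closure_of G = topspace T \<and> G \<subseteq> S)"

end

theory Submission
  imports Defs
begin

text \<open>
  Continuity of the class map makes the relations \<open>\<sim>\<^sub>\<beta>\<close> converge to
  \<open>\<sim>\<close> uniformly: for small \<open>\<beta>\<close> each
  \<open>\<sim>\<^sub>\<beta>\<close>-class lies near a single \<open>\<sim>\<close>-class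
  (\<open>chain_rel_delta_near_class\<close>). The points \<open>x\<^sub>k\<close> of an ordinary
  \<open>\<beta>\<close>-pseudo-orbit satisfy \<open>f\<^sup>k(x\<^sub>0) \<sim>\<^sub>\<beta>
  x\<^sub>k\<close>, so they can be pushed into the classes of
  \<open>f\<^sup>k(x\<^sub>0)\<close>. Hence every ordinary pseudo-orbit is shadowed by a point
  equivalent to its initial point (\<open>pseudo_orbits_shadowed_in_class\<close>).

  The \<open>\<beta>\<close>-chains from one \<open>\<sim>\<^sub>\<beta>\<close>-class to another
  realise all large lengths of one residue class. So \<open>n\<close> equivalent points
  \<open>x\<^sub>i\<close> can be joined to any \<open>n\<close> equivalent targets
  \<open>z\<^sub>i\<close> by chains of the same length, and there are points \<open>y\<^sub>i
  \<sim> x\<^sub>i\<close>, near \<open>x\<^sub>i\<close>, that follow the orbits of the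
  \<open>z\<^sub>i\<close> from a common time on (\<open>simultaneous_tracing\<close>). Equal
  targets yield proximal tuples near a given one, and targets whose orbits stay at least
  \<open>c\<close> apart for ever yield tuples separated by \<open>c / 2\<close>. Both conditions of
  distributional chaos are countable intersections of open conditions, and each of these holds on
  a dense set because tuples of the one or the other kind satisfy it; so Baire's theorem applies.
  The number \<open>c\<close> depends only on the targets, which need not lie in the class
  \<open>D\<close> under consideration.

  It remains to find \<open>n\<close> equivalent points with uniformly separated orbits. If some
  class contains \<open>n\<close> distinct points \<open>a\<^sub>i\<close>, take periodic
  pseudo-orbits of one common period through the \<open>a\<^sub>i\<close>: points shadowing them
  are apart at all multiples of the period and so, by uniform continuity, at all times
  (\<open>uniformly_separated_orbits_in_class\<close>). The entropy hypothesis provides such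
  classes: if the cardinalities of the classes had a maximum \<open>M\<close>, the
  \<open>M\<close> uniformly separated orbits just found would exhaust the classes that they
  visit, which forces every point to be an equicontinuity point and the entropy to vanish.
\<close>

section \<open>Lengths of chains\<close>

definition chain_to :: "('a::metric_space \<Rightarrow> 'a) \<Rightarrow> real \<Rightarrow> nat \<Rightarrow> 'a \<Rightarrow> 'a \<Rightarrow> bool" where
  "chain_to f \<delta> k x y \<longleftrightarrow> (\<exists>c. delta_chain f \<delta> k c \<and> c 0 = x \<and> c k = y)"

lemma chain_to_length_pos: "chain_to f \<delta> k x y \<Longrightarrow> 0 < k"
  by (auto simp: chain_to_def delta_chain_def)

lemma chain_to_trans:
  assumes "chain_to f \<delta> k x y" "chain_to f \<delta> l y z"
  shows "chain_to f \<delta> (k + l) x z"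
proof -
  obtain c where c: "delta_chain f \<delta> k c" "c 0 = x" "c k = y"
    using assms(1) by (auto simp: chain_to_def)
  obtain e where e: "delta_chain f \<delta> l e" "e 0 = y" "e l = z"
    using assms(2) by (auto simp: chain_to_def)
  define b where "b = (\<lambda>i. if i \<le> k then c i else e (i - k))"
  have "dist (f (b i)) (b (Suc i)) \<le> \<delta>" if "i < k + l" for i
  proof (cases "i < k")
    case True
    then show ?thesis using c by (auto simp: b_def delta_chain_def)
  next
    case False
    then have "b i = e (i - k)" "b (Suc i) = e (Suc (i - k))" "i - k < l"
      using that c e by (auto simp: b_def Suc_diff_le)
    then show ?thesis using e by (auto simp: delta_chain_def)
  qed
  then have "delta_chain f \<delta> (k + l) b" "b 0 = x" "b (k + l) = z"
    using c e by (auto simp: b_def delta_chain_def)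
  then show ?thesis by (auto simp: chain_to_def)
qed

lemma chain_to_mono: "chain_to f \<delta> k x y \<Longrightarrow> \<delta> \<le> \<delta>' \<Longrightarrow> chain_to f \<delta>' k x y"
  by (force simp: chain_to_def delta_chain_def)

lemma chain_to_perturb_end:
  assumes "chain_to f \<delta> k x y" "dist y z \<le> \<eta>" "0 \<le> \<eta>"
  shows "chain_to f (\<delta> + \<eta>) k x z"
proof -
  obtain c where c: "delta_chain f \<delta> k c" "c 0 = x" "c k = y"
    using assms(1) by (auto simp: chain_to_def)
  have "dist (f (c i)) ((c(k := z)) (Suc i)) \<le> \<delta> + \<eta>" if "i < k" for i
  proof -
    have "dist (f (c i)) (c (Suc i)) \<le> \<delta>" using c that by (auto simp: delta_chain_def)
    then show ?thesis
      using assms c dist_triangle[of "f (c i)" z y] by auto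
  qed
  then have "delta_chain f (\<delta> + \<eta>) k (c(k := z))" "(c(k := z)) 0 = x" "(c(k := z)) k = z"
    using c by (auto simp: delta_chain_def)
  then show ?thesis unfolding chain_to_def by blast
qed

text \<open>Two elements \<open>a\<close> and \<open>a + d\<close> of the set with minimal positive gap \<open>d\<close> already determine it
  from some point on: a remainder modulo \<open>d\<close> of an element would again be a gap, so \<open>d\<close> is the gcd
  \<open>g\<close>, and with \<open>a = g b\<close> the number \<open>g (b u + v)\<close>, where \<open>v < b \<le> u\<close>, equals
  \<open>(u - v) a + v (a + g)\<close>.\<close>

lemma additive_set_contains_multiples_of_Gcd:
  fixes S :: "nat set"
  assumes add: "\<And>a b. a \<in> S \<Longrightarrow> b \<in> S \<Longrightarrow> a + b \<in> S" and "s \<in> S" "0 < s"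
  shows "\<exists>K. \<forall>q\<ge>K. Gcd S * q \<in> S"
proof -
  have mult: "Suc q * a \<in> S" if "a \<in> S" for q a
    by (induction q) (use that add in auto)
  define gap where "gap = (\<lambda>d. 0 < d \<and> (\<exists>a\<in>S. a + d \<in> S))"
  have "gap s" using assms by (auto simp: gap_def)
  define d where "d = (LEAST d. gap d)"
  have "gap d" unfolding d_def using \<open>gap s\<close> by (rule LeastI)
  then obtain a where a: "0 < d" "a \<in> S" "a + d \<in> S" by (auto simp: gap_def)
  have least: "d \<le> e" if "gap e" for e
    unfolding d_def using that by (rule Least_le)
  have "d dvd t" if "t \<in> S" for t
  proof (rule ccontr)
    assume nd: "\<not> d dvd t"
    then have r: "0 < t mod d" "t mod d < d" using a by (auto simp: dvd_eq_mod_eq_0)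
    show False
    proof (cases "t div d")
      case 0
      then have "t < d" using a by (simp add: div_eq_0_iff)
      then show False
        using least[of t] that nd add[OF that that] by (cases "t = 0") (auto simp: gap_def)
    next
      case (Suc q)
      have t: "t = Suc q * d + t mod d" using Suc by (metis div_mult_mod_eq)
      have "Suc q * (a + d) \<in> S" "t + Suc q * a \<in> S"
        using mult a that add by blast+
      moreover have "t + Suc q * a = Suc q * (a + d) + t mod d"
        by (subst t) (simp add: algebra_simps)
      ultimately have "gap (t mod d)" using r unfolding gap_def by metis
      then show False using least[of "t mod d"] r by simp
    qed
  qed
  then have "d dvd Gcd S" by (rule Gcd_greatest)
  moreover have "Gcd S dvd d"
    using a Gcd_dvd[of a S] Gcd_dvd[of "a + d" S] dvd_add_right_iff by blast
  ultimately have g: "Gcd S = d" by (simp add: dvd_antisym)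
  obtain b where b: "a = d * b" using Gcd_dvd[OF \<open>a \<in> S\<close>] g by (auto simp: dvd_def)
  show ?thesis
  proof (cases "b = 0")
    case True
    then have "d * q \<in> S" if "1 \<le> q" for q
      using mult[of "a + d" "q - 1"] a b that by (simp add: mult.commute)
    then show ?thesis using g by auto
  next
    case False
    have "d * q \<in> S" if "b * b \<le> q" for q
    proof -
      define u v where "u = q div b" and "v = q mod b"
      have q: "q = b * u + v" by (simp add: u_def v_def)
      have "v < b" using False by (simp add: v_def)
      moreover have "b \<le> u" using that False by (simp add: u_def less_eq_div_iff_mult_less_eq)
      ultimately have uv: "v < u" by simp
      have in1: "Suc (u - v - 1) * a \<in> S" using mult a by blast
      have eq: "d * q = (u - v) * a + v * (a + d)"
      proof -
        obtain w where w: "u = v + w" using uv less_imp_add_positive by blast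
        show ?thesis by (simp add: q b w algebra_simps)
      qed
      show ?thesis
      proof (cases v)
        case 0
        then show ?thesis using eq in1 uv by simp
      next
        case (Suc v')
        have "Suc (u - v - 1) * a + Suc v' * (a + d) \<in> S"
          using in1 mult[OF a(3), of v'] add by blast
        moreover have "Suc (u - v - 1) = u - v" using uv by simp
        ultimately show ?thesis using eq Suc by metis
      qed
    qed
    then show ?thesis using g by auto
  qed
qed

locale chain_transitive_map =
  fixes f :: "'a::metric_space \<Rightarrow> 'a"
  assumes compact_space: "compact (UNIV :: 'a set)"
    and cont: "continuous_on UNIV f"
    and trans: "chain_transitive f"
begin

lemma chain_to_exists: "0 < \<delta> \<Longrightarrow> \<exists>k. chain_to f \<delta> k x y"
  using trans by (auto simp: chain_transitive_def chain_to_def)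

lemma chain_to_orbit: "0 \<le> \<delta> \<Longrightarrow> 0 < k \<Longrightarrow> chain_to f \<delta> k x ((f ^^ k) x)"
  unfolding chain_to_def delta_chain_def by (rule exI[of _ "\<lambda>i. (f ^^ i) x"]) auto

lemma cycle_gcd_dvd: "chain_to f \<delta> k x x \<Longrightarrow> cycle_gcd f \<delta> dvd k"
  unfolding cycle_gcd_def chain_to_def by (rule Gcd_dvd) auto

lemma chain_rel_delta_iff:
  "(x, y) \<in> chain_rel_delta f \<delta> \<longleftrightarrow> (\<exists>k. chain_to f \<delta> k x y \<and> cycle_gcd f \<delta> dvd k)"
  by (auto simp: chain_rel_delta_def chain_to_def)

text \<open>A cycle at any point \<open>w\<close> can be inserted into a cycle at \<open>x\<close> that passes through \<open>w\<close>, so its length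
  is a difference of lengths of cycles at \<open>x\<close>.\<close>

lemma cycle_gcd_eq_Gcd_at_point:
  assumes "0 < \<delta>"
  shows "cycle_gcd f \<delta> = Gcd {k. chain_to f \<delta> k x x}"
proof (rule dvd_antisym)
  show "cycle_gcd f \<delta> dvd Gcd {k. chain_to f \<delta> k x x}"
    using cycle_gcd_dvd by (auto intro: Gcd_greatest)
  show "Gcd {k. chain_to f \<delta> k x x} dvd cycle_gcd f \<delta>"
    unfolding cycle_gcd_def
  proof (rule Gcd_greatest, clarify)
    fix l c assume c: "delta_chain f \<delta> l c" "c 0 = c l"
    define w where "w = c 0"
    have l: "chain_to f \<delta> l w w" using c by (auto simp: chain_to_def w_def)
    obtain a b where a: "chain_to f \<delta> a x w" and b: "chain_to f \<delta> b w x"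
      using chain_to_exists assms by blast
    have "chain_to f \<delta> (a + b) x x" "chain_to f \<delta> (a + l + b) x x"
      using chain_to_trans a b l by blast+
    then have "Gcd {k. chain_to f \<delta> k x x} dvd a + b" "Gcd {k. chain_to f \<delta> k x x} dvd (a + b) + l"
      by (auto intro!: Gcd_dvd simp: add_ac)
    then show "Gcd {k. chain_to f \<delta> k x x} dvd l"
      using dvd_add_right_iff by blast
  qed
qed

lemma cycles_of_large_length:
  assumes "0 < \<delta>"
  shows "\<exists>K. \<forall>q\<ge>K. chain_to f \<delta> (cycle_gcd f \<delta> * q) x x"
proof -
  obtain s where "chain_to f \<delta> s x x" using chain_to_exists assms by blast
  then have "\<exists>K. \<forall>q\<ge>K. Gcd {k. chain_to f \<delta> k x x} * q \<in> {k. chain_to f \<delta> k x x}"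
    using chain_to_trans chain_to_length_pos
    by (intro additive_set_contains_multiples_of_Gcd[of _ s]) auto
  then show ?thesis using cycle_gcd_eq_Gcd_at_point[OF assms, of x] by simp
qed

lemma cycle_gcd_pos:
  assumes "0 < \<delta>"
  shows "0 < cycle_gcd f \<delta>"
proof -
  obtain s where "chain_to f \<delta> s undefined undefined" using chain_to_exists assms by blast
  then show ?thesis using cycle_gcd_dvd chain_to_length_pos by (metis dvd_0_left_iff gr0I)
qed

section \<open>The chain relations\<close>

lemma equiv_chain_rel_delta:
  assumes "0 < \<delta>"
  shows "equiv UNIV (chain_rel_delta f \<delta>)"
proof (rule equivI)
  show "refl (chain_rel_delta f \<delta>)"
    using chain_to_exists[OF assms] cycle_gcd_dvd unfolding refl_on_def chain_rel_delta_iff by blast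
  show "Relation.trans (chain_rel_delta f \<delta>)"
    using chain_to_trans dvd_add unfolding Relation.trans_def chain_rel_delta_iff by blast
  show "sym (chain_rel_delta f \<delta>)"
  proof (rule symI)
    fix x y assume "(x, y) \<in> chain_rel_delta f \<delta>"
    then obtain k where k: "chain_to f \<delta> k x y" "cycle_gcd f \<delta> dvd k"
      by (auto simp: chain_rel_delta_iff)
    obtain l where l: "chain_to f \<delta> l y x" using chain_to_exists assms by blast
    have "cycle_gcd f \<delta> dvd k + l" using cycle_gcd_dvd chain_to_trans k l by blast
    then show "(y, x) \<in> chain_rel_delta f \<delta>"
      using k l dvd_add_right_iff by (auto simp: chain_rel_delta_iff)
  qed
qed simp

lemma chain_rel_delta_refl: "0 < \<delta> \<Longrightarrow> (x, x) \<in> chain_rel_delta f \<delta>"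
  using equiv_chain_rel_delta by (meson UNIV_I equivE refl_onD)

lemma chain_rel_delta_sym:
  "0 < \<delta> \<Longrightarrow> (x, y) \<in> chain_rel_delta f \<delta> \<Longrightarrow> (y, x) \<in> chain_rel_delta f \<delta>"
  using equiv_chain_rel_delta by (meson equivE symD)

lemma chain_rel_delta_trans:
  "0 < \<delta> \<Longrightarrow> (x, y) \<in> chain_rel_delta f \<delta> \<Longrightarrow> (y, z) \<in> chain_rel_delta f \<delta> \<Longrightarrow>
    (x, z) \<in> chain_rel_delta f \<delta>"
  using equiv_chain_rel_delta by (meson equivE transD)

lemma chain_rel_delta_mono:
  assumes "0 < \<delta>" "\<delta> \<le> \<delta>'" "(x, y) \<in> chain_rel_delta f \<delta>"
  shows "(x, y) \<in> chain_rel_delta f \<delta>'"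
proof -
  have "cycle_gcd f \<delta>' dvd cycle_gcd f \<delta>"
    unfolding cycle_gcd_def[of f \<delta>]
  proof (rule Gcd_greatest, clarify)
    fix k c assume "delta_chain f \<delta> k c" "c 0 = c k"
    then have "chain_to f \<delta> k (c 0) (c 0)" by (auto simp: chain_to_def)
    then show "cycle_gcd f \<delta>' dvd k"
      using cycle_gcd_dvd chain_to_mono[OF _ assms(2)] by blast
  qed
  then show ?thesis
    using assms chain_to_mono by (meson chain_rel_delta_iff dvd_trans)
qed

text \<open>Replacing the last point of a cycle at \<open>x\<close> by the nearby point \<open>y\<close> does not change its
  length.\<close>

lemma chain_rel_delta_if_close:
  assumes "0 < \<delta>" "dist x y \<le> \<delta> / 2"
  shows "(x, y) \<in> chain_rel_delta f \<delta>"
proof -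
  obtain k where k: "chain_to f (\<delta> / 2) k x x" using chain_to_exists assms by (meson half_gt_zero)
  have "chain_to f \<delta> k x x" using chain_to_mono[OF k] assms by simp
  moreover have "chain_to f (\<delta> / 2 + \<delta> / 2) k x y"
    using chain_to_perturb_end[OF k assms(2)] assms(1) by simp
  ultimately show ?thesis using cycle_gcd_dvd unfolding chain_rel_delta_iff field_sum_of_halves by blast
qed

text \<open>Going back from \<open>u\<close> to \<open>x\<close>, over to \<open>y\<close> and on to \<open>v\<close> takes a number of steps divisible by the gcd,
  since the way from \<open>x\<close> to \<open>u\<close> and the way from \<open>y\<close> to \<open>v\<close> are equally long.\<close>

lemma chain_rel_delta_step:
  assumes "0 < \<delta>" "(x, y) \<in> chain_rel_delta f \<delta>" "chain_to f \<delta> k x u" "chain_to f \<delta> k y v"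
  shows "(u, v) \<in> chain_rel_delta f \<delta>"
proof -
  obtain p where p: "chain_to f \<delta> p u x" using chain_to_exists assms by blast
  obtain q where q: "chain_to f \<delta> q x y" "cycle_gcd f \<delta> dvd q"
    using assms by (auto simp: chain_rel_delta_iff)
  have "chain_to f \<delta> (p + q + k) u v" using chain_to_trans p q assms by blast
  moreover have "cycle_gcd f \<delta> dvd k + p" using cycle_gcd_dvd chain_to_trans assms p by blast
  then have "cycle_gcd f \<delta> dvd (k + p) + q" using q(2) by (rule dvd_add)
  then have "cycle_gcd f \<delta> dvd p + q + k" by (simp add: add_ac)
  ultimately show ?thesis by (auto simp: chain_rel_delta_iff)
qed

lemma equiv_chain_rel: "equiv UNIV (chain_rel f)"
proof (rule equivI)
  show "refl (chain_rel f)"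
    using chain_rel_delta_refl by (auto simp: refl_on_def chain_rel_def)
  show "sym (chain_rel f)"
    using chain_rel_delta_sym by (auto simp: sym_def chain_rel_def)
  show "Relation.trans (chain_rel f)"
    using chain_rel_delta_trans unfolding Relation.trans_def chain_rel_def by blast
qed simp

lemma chain_rel_refl [simp]: "(x, x) \<in> chain_rel f"
  using equiv_chain_rel by (simp add: equiv_class_eq_iff)

lemma chain_rel_sym: "(x, y) \<in> chain_rel f \<Longrightarrow> (y, x) \<in> chain_rel f"
  using equiv_chain_rel by (meson equivE symD)

lemma chain_rel_trans: "(x, y) \<in> chain_rel f \<Longrightarrow> (y, z) \<in> chain_rel f \<Longrightarrow> (x, z) \<in> chain_rel f"
  using equiv_chain_rel by (meson equivE transD)

lemma chain_rel_funpow: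
  assumes "(x, y) \<in> chain_rel f"
  shows "((f ^^ k) x, (f ^^ k) y) \<in> chain_rel f"
proof (cases "k = 0")
  case False
  then show ?thesis
    using assms chain_rel_delta_step[OF _ _ chain_to_orbit chain_to_orbit]
    by (auto simp: chain_rel_def)
qed (use assms in simp)

lemma chain_rel_delta_closed_limit:
  assumes "0 < \<delta>" "u \<longlonglongrightarrow> x" "v \<longlonglongrightarrow> y" "\<And>n. (u n, v n) \<in> chain_rel_delta f (e n)"
    "e \<longlonglongrightarrow> 0" "\<And>n. 0 < e n"
  shows "(x, y) \<in> chain_rel_delta f \<delta>"
proof -
  have "\<forall>\<^sub>F n in sequentially. dist (u n) x < \<delta> / 2"
    "\<forall>\<^sub>F n in sequentially. dist (v n) y < \<delta> / 2"
    "\<forall>\<^sub>F n in sequentially. e n < \<delta>"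
    using assms(1) tendstoD[OF assms(2), of "\<delta> / 2"] tendstoD[OF assms(3), of "\<delta> / 2"]
      order_tendstoD(2)[OF assms(5), of \<delta>] by simp_all
  then have "\<forall>\<^sub>F n in sequentially. dist (u n) x < \<delta> / 2 \<and> dist (v n) y < \<delta> / 2 \<and> e n < \<delta>"
    by (intro eventually_conj)
  then obtain n where n: "dist x (u n) < \<delta> / 2" "dist (v n) y < \<delta> / 2" "e n < \<delta>"
    by (auto dest: eventually_happens simp: dist_commute)
  have "(x, u n) \<in> chain_rel_delta f \<delta>" "(v n, y) \<in> chain_rel_delta f \<delta>"
    using n assms by (auto intro: chain_rel_delta_if_close)
  moreover have "(u n, v n) \<in> chain_rel_delta f \<delta>"
    using chain_rel_delta_mono assms n by (meson less_imp_le)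
  ultimately show ?thesis using chain_rel_delta_trans assms(1) by blast
qed

lemma closed_chain_rel_class: "closed (chain_rel f `` {x})"
  unfolding closed_sequential_limits
proof (intro allI impI, elim conjE)
  fix v y assume v: "\<forall>n. v n \<in> chain_rel f `` {x}" "v \<longlonglongrightarrow> y"
  have "(x, y) \<in> chain_rel_delta f \<delta>" if "0 < \<delta>" for \<delta>
    using v that
    by (intro chain_rel_delta_closed_limit[OF that tendsto_const[of x] v(2),
          where e = "\<lambda>n. inverse (real (Suc n))"] LIMSEQ_inverse_real_of_nat) (auto simp: chain_rel_def)
  then show "y \<in> chain_rel f `` {x}" by (auto simp: chain_rel_def)
qed

text \<open>All chains between two given classes have lengths in one residue class modulo the gcd of the
  cycle lengths, and all large numbers of this residue class occur. Finitely many such pairs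
  therefore share a length.\<close>

lemma common_chain_length:
  assumes "0 < \<delta>" "finite I"
    and x: "\<And>i. i \<in> I \<Longrightarrow> (x i, x') \<in> chain_rel_delta f \<delta>"
    and z: "\<And>i. i \<in> I \<Longrightarrow> (z', z i) \<in> chain_rel_delta f \<delta>"
  shows "\<exists>L>0. \<forall>i\<in>I. chain_to f \<delta> L (x i) (z i)"
proof -
  define m where "m = cycle_gcd f \<delta>"
  have "0 < m" using cycle_gcd_pos assms by (simp add: m_def)
  obtain r where r: "chain_to f \<delta> r x' z'" using chain_to_exists assms by blast
  have "\<forall>\<^sub>F J in sequentially. chain_to f \<delta> (r + m * J) (x i) (z i)" if i: "i \<in> I" for i
  proof -
    obtain p where p: "chain_to f \<delta> p (x i) x'" "m dvd p"
      using x[OF i] by (auto simp: chain_rel_delta_iff m_def)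
    obtain s where s: "chain_to f \<delta> s z' (z i)" "m dvd s"
      using z[OF i] by (auto simp: chain_rel_delta_iff m_def)
    obtain K where K: "\<And>q. q \<ge> K \<Longrightarrow> chain_to f \<delta> (m * q) (z i) (z i)"
      using cycles_of_large_length assms unfolding m_def by blast
    obtain p' s' where ps: "p = m * p'" "s = m * s'" using p s by (auto simp: dvd_def)
    have "chain_to f \<delta> (r + m * J) (x i) (z i)" if "J \<ge> K + p' + s'" for J
    proof -
      have "chain_to f \<delta> (p + r + s + m * (J - p' - s')) (x i) (z i)"
        using chain_to_trans[OF chain_to_trans[OF chain_to_trans[OF p(1) r] s(1)] K] that by simp
      moreover have "p + r + s + m * (J - p' - s') = r + m * J"
      proof -
        obtain t where "J = t + p' + s'" using \<open>J \<ge> K + p' + s'\<close> by (metis add.assoc le_Suc_ex add.commute)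
        then show ?thesis by (simp add: ps algebra_simps)
      qed
      ultimately show ?thesis by metis
    qed
    then show ?thesis by (auto simp: eventually_sequentially)
  qed
  then have "\<forall>\<^sub>F J in sequentially. \<forall>i\<in>I. chain_to f \<delta> (r + m * J) (x i) (z i)"
    using assms(2) by (simp add: eventually_ball_finite)
  then obtain J where "\<forall>i\<in>I. chain_to f \<delta> (r + m * J) (x i) (z i)"
    by (auto simp: eventually_sequentially)
  then show ?thesis using chain_to_length_pos[OF r] by (intro exI[of _ "r + m * J"]) auto
qed

section \<open>Shadowing of ordinary pseudo-orbits\<close>

lemma uniformly_continuous_funpow:
  assumes "0 < e"
  shows "\<exists>d>0. \<forall>r\<le>N. \<forall>u v. dist u v < d \<longrightarrow> dist ((f ^^ r) u) ((f ^^ r) v) < e"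
  using assms
proof (induction N arbitrary: e)
  case 0
  then show ?case by auto
next
  case (Suc N)
  have "uniformly_continuous_on UNIV f" using compact_space cont by (rule compact_uniformly_continuous[rotated])
  then obtain e' where e': "0 < e'" "\<And>u v. dist u v < e' \<Longrightarrow> dist (f u) (f v) < e"
    using Suc.prems unfolding uniformly_continuous_on_def by (metis UNIV_I)
  obtain d where d: "0 < d" "\<And>r u v. r \<le> N \<Longrightarrow> dist u v < d \<Longrightarrow> dist ((f ^^ r) u) ((f ^^ r) v) < min e e'"
    using Suc.IH[of "min e e'"] Suc.prems e'(1) by auto
  have "dist ((f ^^ r) u) ((f ^^ r) v) < e" if "r \<le> Suc N" "dist u v < d" for r u v
  proof (cases "r \<le> N")
    case True
    then show ?thesis using d(2)[OF True that(2)] by simp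
  next
    case False
    then have "r = Suc N" using that by simp
    then show ?thesis using d(2)[of N u v] e'(2) that by simp
  qed
  then show ?case using d(1) by blast
qed

lemma continuous_funpow: "continuous_on UNIV (f ^^ k)"
proof (induction k)
  case (Suc k)
  then show ?case using cont continuous_on_compose2 by (fastforce simp: o_def)
qed (simp add: id_def)

end

locale class_shadowing_map = chain_transitive_map +
  assumes shadowing: "shadowing_along_classes f"
    and continuous_class: "continuous_map euclidean (Metric_space.mtopology hyperspace hausdorff_dist) (chain_class f)"
begin

text \<open>Lower semicontinuity of the class map. Together with the closedness of the relation it amounts to
  continuity in the Hausdorff metric.\<close>

lemma class_lower_semicontinuous:
  assumes "0 < \<gamma>"
  shows "\<exists>\<eta>>0. \<forall>x'. dist x' x < \<eta> \<longrightarrow>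
    (\<forall>y. (x, y) \<in> chain_rel f \<longrightarrow> (\<exists>y'. (x', y') \<in> chain_rel f \<and> dist y y' < \<gamma>))"
proof -
  interpret H: Metric_space "hyperspace :: 'a set set" hausdorff_dist
    using compact_space by (rule Metric_space_hausdorff)
  obtain U where U: "open U" "x \<in> U"
    "\<And>x'. x' \<in> U \<Longrightarrow> hausdorff_dist (chain_class f x) (chain_class f x') < \<gamma>"
    using continuous_class assms unfolding H.continuous_map_to_metric
    by (simp add: H.in_mball) meson
  obtain \<eta> where \<eta>: "0 < \<eta>" "ball x \<eta> \<subseteq> U" using U openE by blast
  have "\<exists>y'. (x', y') \<in> chain_rel f \<and> dist y y' < \<gamma>"
    if x': "dist x' x < \<eta>" and y: "(x, y) \<in> chain_rel f" for x' y
  proof -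
    let ?S = "{\<epsilon>. \<epsilon> > 0 \<and> chain_class f x \<subseteq> nbhd \<epsilon> (chain_class f x') \<and> chain_class f x' \<subseteq> nbhd \<epsilon> (chain_class f x)}"
    have "x' \<in> U" using x' \<eta> by (auto simp: dist_commute)
    then have less: "Inf ?S < \<gamma>" using U(3) by (simp add: hausdorff_dist_def)
    \<comment> \<open>The infimum of an empty set of reals is arbitrary; here any number above the diameter
      of the space belongs to the set.\<close>
    have "?S \<noteq> {}"
    proof -
      obtain e where e: "\<And>u v :: 'a. dist u v \<le> e"
        using compact_imp_bounded[OF compact_space] bounded_two_points[of "UNIV :: 'a set"] by auto
      have "infdist u (chain_class f v) < \<bar>e\<bar> + 1" for u v
      proof -
        have "infdist u (chain_class f v) \<le> dist u v"
          by (rule infdist_le) (simp add: chain_class_def)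
        then show ?thesis using e[of u v] by linarith
      qed
      then show ?thesis by (auto simp: nbhd_def intro!: exI[of _ "\<bar>e\<bar> + 1"])
    qed
    then obtain \<epsilon> where "\<epsilon> \<in> ?S" "\<epsilon> < \<gamma>" using cInf_lessD[OF _ less] by blast
    then have "infdist y (chain_class f x') < \<gamma>"
      using y by (force simp: nbhd_def chain_class_def)
    moreover have ne: "chain_class f x' \<noteq> {}" using chain_rel_refl[of x'] unfolding chain_class_def by blast
    ultimately obtain y' where "y' \<in> chain_class f x'" "dist y y' < \<gamma>"
      by (auto simp: infdist_def cInf_less_iff)
    then show ?thesis by (auto simp: chain_class_def)
  qed
  then show ?thesis using \<eta>(1) by blast
qed

text \<open>A limit \<open>(x, y)\<close> of counterexamples for \<open>\<beta> \<rightarrow> 0\<close> would satisfy \<open>x \<sim> y\<close>, and then the classes of points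
  near \<open>x\<close> would come close to \<open>y\<close>.\<close>

lemma chain_rel_delta_near_class:
  assumes "0 < \<gamma>"
  shows "\<exists>\<beta>>0. \<forall>x y. (x, y) \<in> chain_rel_delta f \<beta> \<longrightarrow> (\<exists>y'. (x, y') \<in> chain_rel f \<and> dist y y' < \<gamma>)"
proof (rule ccontr)
  assume "\<not> ?thesis"
  then have "\<exists>x y. (x, y) \<in> chain_rel_delta f (inverse (real (Suc n))) \<and>
      (\<forall>y'. (x, y') \<in> chain_rel f \<longrightarrow> \<not> dist y y' < \<gamma>)" for n
    by (metis inverse_positive_iff_positive of_nat_0_less_iff zero_less_Suc)
  then obtain u v where uv: "\<And>n. (u n, v n) \<in> chain_rel_delta f (inverse (real (Suc n)))"
    and far: "\<And>n y'. (u n, y') \<in> chain_rel f \<Longrightarrow> \<not> dist (v n) y' < \<gamma>"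
    by metis
  have seq: "seq_compact (UNIV :: 'a set)" using compact_space by (rule compact_imp_seq_compact)
  obtain x r where r: "strict_mono r" "(u \<circ> r) \<longlonglongrightarrow> x"
    using seq unfolding seq_compact_def by (metis UNIV_I)
  obtain y s where s: "strict_mono s" "(v \<circ> r \<circ> s) \<longlonglongrightarrow> y"
    using seq unfolding seq_compact_def by (metis UNIV_I)
  define q where "q = r \<circ> s"
  have q: "strict_mono q" using r s by (simp add: q_def strict_mono_o)
  have lim: "(\<lambda>n. u (q n)) \<longlonglongrightarrow> x" "(\<lambda>n. v (q n)) \<longlonglongrightarrow> y"
    using LIMSEQ_subseq_LIMSEQ[OF r(2) s(1)] s(2) by (simp_all add: q_def o_def)
  have "(x, y) \<in> chain_rel f"
    unfolding chain_rel_def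
  proof (clarify)
    fix \<delta> :: real assume "0 < \<delta>"
    then show "(x, y) \<in> chain_rel_delta f \<delta>"
      by (rule chain_rel_delta_closed_limit[OF _ lim, where e = "\<lambda>n. inverse (real (Suc (q n)))"])
        (use uv LIMSEQ_subseq_LIMSEQ[OF LIMSEQ_inverse_real_of_nat q] in \<open>auto simp: o_def\<close>)
  qed
  obtain \<eta> where \<eta>: "0 < \<eta>"
    "\<And>x'. dist x' x < \<eta> \<Longrightarrow> \<exists>y'. (x', y') \<in> chain_rel f \<and> dist y y' < \<gamma> / 2"
    using class_lower_semicontinuous[of "\<gamma> / 2" x] assms \<open>(x, y) \<in> chain_rel f\<close>
    by (metis half_gt_zero)
  have "\<forall>\<^sub>F n in sequentially. dist (u (q n)) x < \<eta> \<and> dist (v (q n)) y < \<gamma> / 2"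
    using tendstoD[OF lim(1), of \<eta>] tendstoD[OF lim(2), of "\<gamma> / 2"] \<eta>(1) assms
    by (simp add: eventually_conj)
  then obtain n where n: "dist (u (q n)) x < \<eta>" "dist (v (q n)) y < \<gamma> / 2"
    by (auto dest: eventually_happens)
  obtain y' where "(u (q n), y') \<in> chain_rel f" "dist y y' < \<gamma> / 2" using \<eta>(2) n(1) by blast
  moreover have "dist (v (q n)) y' < \<gamma>"
    using dist_triangle[of "v (q n)" y' y] n(2) calculation(2) by linarith
  ultimately show False using far by blast
qed

lemma pseudo_orbit_chain_rel_delta:
  assumes "0 < \<beta>" "\<And>k. dist (f (x k)) (x (Suc k)) \<le> \<beta>"
  shows "((f ^^ k) (x 0), x k) \<in> chain_rel_delta f \<beta>"
proof (cases "k = 0")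
  case True
  then show ?thesis using chain_rel_delta_refl[OF assms(1)] by simp
next
  case False
  have "chain_to f \<beta> k (x 0) (x k)"
    using assms False by (auto simp: chain_to_def delta_chain_def)
  then show ?thesis
    using chain_rel_delta_step[OF assms(1) chain_rel_delta_refl[OF assms(1)] chain_to_orbit]
      False assms(1) by simp
qed

text \<open>The \<open>k\<close>-th point of the pseudo-orbit is moved by less than \<open>\<gamma>\<close> to a point equivalent to \<open>f\<^sup>k(x\<^sub>0)\<close>.
  The result is a pseudo-orbit along classes, with the error enlarged by \<open>\<gamma>\<close> and by the oscillation
  of \<open>f\<close> on sets of diameter \<open>\<gamma>\<close>.\<close>

lemma pseudo_orbits_shadowed_in_class:
  assumes "0 < \<epsilon>"
  shows "\<exists>\<beta>>0. \<forall>x. (\<forall>k. dist (f (x k)) (x (Suc k)) \<le> \<beta>) \<longrightarrow>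
    (\<exists>y. (x 0, y) \<in> chain_rel f \<and> (\<forall>k. dist ((f ^^ k) y) (x k) \<le> \<epsilon>))"
proof -
  obtain \<delta> where \<delta>: "0 < \<delta>" "\<And>x. class_pseudo_orbit f \<delta> x \<Longrightarrow>
      \<exists>y. (x 0, y) \<in> chain_rel f \<and> (\<forall>k. dist ((f ^^ k) y) (x k) \<le> \<epsilon> / 2)"
    using shadowing assms unfolding shadowing_along_classes_def by (metis half_gt_zero)
  obtain \<omega> where \<omega>: "0 < \<omega>" "\<And>u v. dist u v < \<omega> \<Longrightarrow> dist (f u) (f v) < \<delta> / 3"
  proof -
    obtain d where "0 < d" "\<forall>r\<le>1. \<forall>u v. dist u v < d \<longrightarrow> dist ((f ^^ r) u) ((f ^^ r) v) < \<delta> / 3"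
      using uniformly_continuous_funpow[of "\<delta> / 3" 1] \<delta>(1) by auto
    then show thesis using that[of d] by force
  qed
  define \<gamma> where "\<gamma> = Min {\<omega>, \<delta> / 3, \<epsilon> / 2}"
  have \<gamma>: "0 < \<gamma>" "\<gamma> \<le> \<omega>" "\<gamma> \<le> \<delta> / 3" "\<gamma> \<le> \<epsilon> / 2" using \<omega> \<delta> assms by (auto simp: \<gamma>_def)
  obtain \<beta>' where \<beta>': "0 < \<beta>'"
    "\<And>x y. (x, y) \<in> chain_rel_delta f \<beta>' \<Longrightarrow> \<exists>y'. (x, y') \<in> chain_rel f \<and> dist y y' < \<gamma>"
    using chain_rel_delta_near_class[OF \<gamma>(1)] by blast
  define \<beta> where "\<beta> = min \<beta>' (\<delta> / 3)"
  have \<beta>: "0 < \<beta>" "\<beta> \<le> \<beta>'" "\<beta> \<le> \<delta> / 3" using \<beta>' \<delta> by (auto simp: \<beta>_def)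
  have "\<exists>y. (x 0, y) \<in> chain_rel f \<and> (\<forall>k. dist ((f ^^ k) y) (x k) \<le> \<epsilon>)"
    if x: "\<And>k. dist (f (x k)) (x (Suc k)) \<le> \<beta>" for x
  proof -
    have "\<exists>y'. ((f ^^ k) (x 0), y') \<in> chain_rel f \<and> dist (x k) y' < \<gamma>" for k
      using \<beta>'(2) \<beta> pseudo_orbit_chain_rel_delta[of \<beta> x, OF \<beta>(1) x] chain_rel_delta_mono by blast
    then obtain x' where x': "\<And>k. ((f ^^ k) (x 0), x' k) \<in> chain_rel f" "\<And>k. dist (x k) (x' k) < \<gamma>"
      by metis
    have "class_pseudo_orbit f \<delta> x'"
      unfolding class_pseudo_orbit_def
    proof (intro allI conjI)
      fix k
      have "(f ((f ^^ k) (x 0)), f (x' k)) \<in> chain_rel f"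
        using chain_rel_funpow[OF x'(1), of 1] by simp
      then show "(f (x' k), x' (Suc k)) \<in> chain_rel f"
        by (rule chain_rel_trans[OF chain_rel_sym]) (use x'(1)[of "Suc k"] in simp)
      have "dist (f (x' k)) (f (x k)) < \<delta> / 3" using x'(2)[of k] \<gamma> \<omega> by (simp add: dist_commute)
      then show "dist (f (x' k)) (x' (Suc k)) \<le> \<delta>"
        using x[of k] x'(2)[of "Suc k"] \<gamma> \<beta>
          dist_triangle[of "f (x' k)" "x' (Suc k)" "f (x k)"]
          dist_triangle[of "f (x k)" "x' (Suc k)" "x (Suc k)"] by linarith
    qed
    then obtain y where y: "(x' 0, y) \<in> chain_rel f" "\<And>k. dist ((f ^^ k) y) (x' k) \<le> \<epsilon> / 2"
      using \<delta>(2) by blast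
    have "dist ((f ^^ k) y) (x k) \<le> \<epsilon>" for k
      using y(2)[of k] x'(2)[of k] \<gamma>(4) dist_triangle[of "(f ^^ k) y" "x k" "x' k"]
      by (simp add: dist_commute)
    moreover have "(x 0, y) \<in> chain_rel f" using chain_rel_trans[OF _ y(1)] x'(1)[of 0] by simp
    ultimately show ?thesis by blast
  qed
  then show ?thesis using \<beta>(1) by blast
qed

text \<open>The pseudo-orbits run from \<open>x i\<close> to \<open>z i\<close> along chains of one common length and follow the
  orbits of the \<open>z i\<close> from then on.\<close>

lemma simultaneous_tracing:
  assumes "0 < \<epsilon>" "finite I"
    and x: "\<And>i. i \<in> I \<Longrightarrow> (x i, x') \<in> chain_rel f"
    and z: "\<And>i. i \<in> I \<Longrightarrow> (z', z i) \<in> chain_rel f"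
  shows "\<exists>L y. \<forall>i\<in>I. (x i, y i) \<in> chain_rel f \<and> dist (y i) (x i) \<le> \<epsilon> \<and>
    (\<forall>k\<ge>L. dist ((f ^^ k) (y i)) ((f ^^ (k - L)) (z i)) \<le> \<epsilon>)"
proof -
  obtain \<beta> where \<beta>: "0 < \<beta>" "\<And>w. (\<And>k. dist (f (w k)) (w (Suc k)) \<le> \<beta>) \<Longrightarrow>
      \<exists>y. (w 0, y) \<in> chain_rel f \<and> (\<forall>k. dist ((f ^^ k) y) (w k) \<le> \<epsilon>)"
    using pseudo_orbits_shadowed_in_class[OF assms(1)] by blast
  obtain L where L: "0 < L" "\<And>i. i \<in> I \<Longrightarrow> chain_to f \<beta> L (x i) (z i)"
    using common_chain_length[OF \<beta>(1) assms(2), of x x' z' z] x z \<beta>(1) unfolding chain_rel_def by blast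
  have "\<exists>y. (x i, y) \<in> chain_rel f \<and> dist y (x i) \<le> \<epsilon> \<and>
      (\<forall>k\<ge>L. dist ((f ^^ k) y) ((f ^^ (k - L)) (z i)) \<le> \<epsilon>)" if i: "i \<in> I" for i
  proof -
    obtain c where c: "delta_chain f \<beta> L c" "c 0 = x i" "c L = z i"
      using L(2)[OF i] by (auto simp: chain_to_def)
    define w where "w = (\<lambda>k. if k < L then c k else (f ^^ (k - L)) (z i))"
    have "dist (f (w k)) (w (Suc k)) \<le> \<beta>" for k
    proof (cases "Suc k = L \<or> L \<le> k")
      case True
      then show ?thesis using c \<beta>(1) by (auto simp: w_def delta_chain_def Suc_diff_le)
    next
      case False
      then show ?thesis using c by (auto simp: w_def delta_chain_def)
    qed
    then obtain y where y: "(w 0, y) \<in> chain_rel f" "\<And>k. dist ((f ^^ k) y) (w k) \<le> \<epsilon>"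
      using \<beta>(2) by blast
    have "w 0 = x i" using L(1) c by (simp add: w_def)
    moreover have "dist ((f ^^ k) y) ((f ^^ (k - L)) (z i)) \<le> \<epsilon>" if "L \<le> k" for k
      using y(2)[of k] that by (simp add: w_def)
    ultimately show ?thesis using y(1) y(2)[of 0] by auto
  qed
  then show ?thesis by (intro exI[of _ L] bchoice) blast
qed

text \<open>The pseudo-orbits are closed chains through the points \<open>a i\<close>, run through periodically, with one
  common period \<open>P\<close>.\<close>

lemma periodic_targets_shadowed:
  assumes "0 < \<epsilon>" "finite I" and a: "\<And>i. i \<in> I \<Longrightarrow> (a', a i) \<in> chain_rel f"
  obtains P z where "0 < P" "\<And>i. i \<in> I \<Longrightarrow> (a i, z i) \<in> chain_rel f"
    "\<And>i j. i \<in> I \<Longrightarrow> dist ((f ^^ (P * j)) (z i)) (a i) \<le> \<epsilon>"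
proof -
  obtain \<beta> where \<beta>: "0 < \<beta>" "\<And>w. (\<And>k. dist (f (w k)) (w (Suc k)) \<le> \<beta>) \<Longrightarrow>
      \<exists>y. (w 0, y) \<in> chain_rel f \<and> (\<forall>k. dist ((f ^^ k) y) (w k) \<le> \<epsilon>)"
    using pseudo_orbits_shadowed_in_class[OF assms(1)] by blast
  obtain P where P: "0 < P" "\<And>i. i \<in> I \<Longrightarrow> chain_to f \<beta> P (a i) (a i)"
    using common_chain_length[OF \<beta>(1) assms(2), of a a' a' a] a chain_rel_sym \<beta>(1)
    unfolding chain_rel_def by blast
  have "\<exists>z. (a i, z) \<in> chain_rel f \<and> (\<forall>j. dist ((f ^^ (P * j)) z) (a i) \<le> \<epsilon>)" if i: "i \<in> I" for i
  proof -
    obtain c where c: "delta_chain f \<beta> P c" "c 0 = a i" "c P = a i"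
      using P(2)[OF i] by (auto simp: chain_to_def)
    define w where "w = (\<lambda>k. c (k mod P))"
    have "dist (f (w k)) (w (Suc k)) \<le> \<beta>" for k
    proof -
      have "w (Suc k) = c (Suc (k mod P))" using c by (auto simp: w_def mod_Suc)
      then show ?thesis using c P(1) by (simp add: w_def delta_chain_def)
    qed
    then obtain z where z: "(w 0, z) \<in> chain_rel f" "\<And>k. dist ((f ^^ k) z) (w k) \<le> \<epsilon>"
      using \<beta>(2) by blast
    have "dist ((f ^^ (P * j)) z) (a i) \<le> \<epsilon>" for j
      using z(2)[of "P * j"] c by (simp add: w_def)
    then show ?thesis using z(1) c by (auto simp: w_def)
  qed
  then show thesis using that P(1) by metis
qed

text \<open>The orbits are apart at all multiples of a period. Every time precedes such a multiple by at most one
  period, so orbits that are very close at some time would be close at the next multiple as well.\<close>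

lemma uniformly_separated_orbits_in_class:
  assumes "finite I" "inj_on a I" and a: "\<And>i. i \<in> I \<Longrightarrow> (a', a i) \<in> chain_rel f"
  obtains c z where "0 < c" "\<And>i. i \<in> I \<Longrightarrow> (a', z i) \<in> chain_rel f"
    "\<And>i j k. i \<in> I \<Longrightarrow> j \<in> I \<Longrightarrow> i \<noteq> j \<Longrightarrow> c \<le> dist ((f ^^ k) (z i)) ((f ^^ k) (z j))"
proof -
  define S where "S = insert 1 ((\<lambda>(i, j). dist (a i) (a j)) ` {(i, j). i \<in> I \<and> j \<in> I \<and> i \<noteq> j})"
  have "finite S"
    unfolding S_def
    by (intro finite.insertI finite_imageI
        finite_subset[OF _ finite_cartesian_product[OF assms(1) assms(1)]]) auto
  \<comment> \<open>The points \<open>a i\<close> are at least \<open>e\<close> apart; the \<open>1\<close> keeps \<open>S\<close> non-empty if there are no pairs.\<close>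
  define e where "e = Min S"
  have "e \<in> S" using \<open>finite S\<close> unfolding e_def by (intro Min_in) (auto simp: S_def)
  then have "0 < e" using assms(2) by (auto simp: S_def inj_on_def)
  have e: "e \<le> dist (a i) (a j)" if "i \<in> I" "j \<in> I" "i \<noteq> j" for i j
    unfolding e_def using \<open>finite S\<close> by (intro Min_le) (use that in \<open>auto simp: S_def\<close>)
  have "0 < e / 4" using \<open>0 < e\<close> by simp
  then obtain P z where P: "0 < P" and z: "\<And>i. i \<in> I \<Longrightarrow> (a i, z i) \<in> chain_rel f"
    "\<And>i j. i \<in> I \<Longrightarrow> dist ((f ^^ (P * j)) (z i)) (a i) \<le> e / 4"
    by (rule periodic_targets_shadowed[of "e / 4" I a' a, OF _ assms(1) a]) blast+
  obtain c where c: "0 < c"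
    "\<And>r u v. r \<le> P \<Longrightarrow> dist u v < c \<Longrightarrow> dist ((f ^^ r) u) ((f ^^ r) v) < e / 2"
    using uniformly_continuous_funpow[of "e / 2" P] \<open>0 < e\<close> by (metis half_gt_zero)
  have sep: "c \<le> dist ((f ^^ k) (z i)) ((f ^^ k) (z j))" if ij: "i \<in> I" "j \<in> I" "i \<noteq> j" for i j k
  proof (rule ccontr)
    assume "\<not> c \<le> dist ((f ^^ k) (z i)) ((f ^^ k) (z j))"
    then have less: "dist ((f ^^ k) (z i)) ((f ^^ k) (z j)) < c" by simp
    define r where "r = P - k mod P"
    have "r + k = P * Suc (k div P)"
    proof -
      have "k mod P \<le> P" using P by (simp add: less_imp_le)
      then show ?thesis using mult_div_mod_eq[of P k]
        unfolding r_def mult_Suc_right by linarith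
    qed
    then have eq: "(f ^^ r) ((f ^^ k) (z l)) = (f ^^ (P * Suc (k div P))) (z l)" for l
      by (metis comp_apply funpow_add)
    have "dist ((f ^^ (P * Suc (k div P))) (z i)) ((f ^^ (P * Suc (k div P))) (z j)) < e / 2"
      using c(2)[OF _ less, of r] unfolding eq by (simp add: r_def del: mult_Suc_right)
    then have "dist (a i) (a j) < e"
      using z(2)[OF ij(1), of "Suc (k div P)"] z(2)[OF ij(2), of "Suc (k div P)"]
        dist_triangle[of "a i" "a j" "(f ^^ (P * Suc (k div P))) (z i)"]
        dist_triangle[of "(f ^^ (P * Suc (k div P))) (z i)" "a j" "(f ^^ (P * Suc (k div P))) (z j)"]
      by (simp add: dist_commute del: mult_Suc_right)
    then show False using e[OF ij] by simp
  qed
  have cls: "(a', z i) \<in> chain_rel f" if "i \<in> I" for i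
    using chain_rel_trans a z(1) that by blast
  show thesis by (rule that[of c z]) (fact c(1), fact cls, fact sep)
qed

end

section \<open>Positive entropy yields large classes\<close>

text \<open>Finitely many of the sets \<open>W\<close> cover the space and each contains at most one point of a separated set.
  So the separated numbers are bounded independently of the length of the orbits.\<close>

lemma topological_entropy_nonpos:
  fixes f :: "'a::metric_space \<Rightarrow> 'a"
  assumes "compact (UNIV :: 'a set)"
    and local: "\<And>\<epsilon> y. 0 < \<epsilon> \<Longrightarrow>
      \<exists>W. open W \<and> y \<in> W \<and> (\<forall>u\<in>W. \<forall>v\<in>W. \<forall>j. dist ((f ^^ j) u) ((f ^^ j) v) \<le> \<epsilon>)"
  shows "topological_entropy f \<le> 0"
  unfolding topological_entropy_def
proof (rule SUP_least)
  fix \<epsilon> :: real assume "\<epsilon> \<in> {0<..}"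
  then have "0 < \<epsilon>" by simp
  define \<W> where "\<W> = {W. open W \<and> (\<forall>u\<in>W. \<forall>v\<in>W. \<forall>j. dist ((f ^^ j) u) ((f ^^ j) v) \<le> \<epsilon>)}"
  have "y \<in> \<Union>\<W>" for y using local[OF \<open>0 < \<epsilon>\<close>, of y] unfolding \<W>_def by blast
  then have "UNIV \<subseteq> \<Union>\<W>" by blast
  moreover have openW: "\<And>W. W \<in> \<W> \<Longrightarrow> open W" by (simp add: \<W>_def)
  ultimately obtain \<U> where \<U>: "\<U> \<subseteq> \<W>" "finite \<U>" "UNIV \<subseteq> \<Union>\<U>"
    using compactE[OF assms(1)] openW by metis
  then have "\<forall>x. \<exists>U\<in>\<U>. x \<in> U" by blast
  then obtain U where U: "\<And>x. U x \<in> \<U>" "\<And>x. x \<in> U x" by metis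
  have card_le: "card E \<le> card \<U>" if E: "separated f n \<epsilon> E" for n E
  proof (rule card_inj_on_le[of U])
    show "inj_on U E"
    proof (rule inj_onI, rule ccontr)
      fix x y assume xy: "x \<in> E" "y \<in> E" "U x = U y" "x \<noteq> y"
      then obtain i where "dist ((f ^^ i) x) ((f ^^ i) y) > \<epsilon>"
        using E unfolding separated_def by blast
      moreover have "dist ((f ^^ i) x) ((f ^^ i) y) \<le> \<epsilon>"
        using \<U>(1) U(1)[of x] U(2)[of x] U(2)[of y] xy(3) by (auto simp: \<W>_def)
      ultimately show False by simp
    qed
  qed (use U \<U> in auto)
  have sep_le: "separated_number f n \<epsilon> \<le> card \<U>" for n
    unfolding separated_number_def
  proof (rule cSup_least)
    show "{card E |E. finite E \<and> separated f n \<epsilon> E} \<noteq> {}"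
      by (auto simp: separated_def intro!: exI[of _ "{}"])
  qed (use card_le in auto)
  have "\<U> \<noteq> {}" using U(1) by blast
  then have C: "1 \<le> card \<U>" using \<U>(2) by (simp add: Suc_le_eq card_gt_0_iff)
  have ln_le: "ln (real (separated_number f n \<epsilon>)) \<le> ln (real (card \<U>))" for n
    using sep_le[of n] C by (cases "separated_number f n \<epsilon> = 0") auto
  have "limsup (\<lambda>n. ereal (ln (real (separated_number f n \<epsilon>)) / real n))
      \<le> limsup (\<lambda>n. ereal (ln (real (card \<U>)) / real n))"
    by (rule Limsup_mono) (auto intro!: always_eventually divide_right_mono ln_le)
  also have "\<dots> = 0"
  proof -
    have "(\<lambda>n. ln (real (card \<U>)) / real n) \<longlonglongrightarrow> 0" by (rule lim_const_over_n)
    then have "(\<lambda>n. ereal (ln (real (card \<U>)) / real n)) \<longlonglongrightarrow> 0"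
      by (simp add: zero_ereal_def)
    then show ?thesis by (simp add: lim_imp_Limsup)
  qed
  finally show "limsup (\<lambda>n. ereal (ln (real (separated_number f n \<epsilon>)) / real n)) \<le> 0" .
qed

context class_shadowing_map
begin

definition class_with_points :: "nat \<Rightarrow> bool" where
  "class_with_points n \<longleftrightarrow>
     (\<exists>a' a. inj_on a {..<n} \<and> (\<forall>i<n. (a', a i) \<in> chain_rel f))"

text \<open>If \<open>M\<close> is the largest cardinality of a class, then \<open>M\<close> uniformly separated orbits starting in one
  class exhaust all the classes that they visit. A point near \<open>z i\<close> is \<open>\<sim>\<^sub>\<beta>\<close>-related to it, so at all
  times its image is close to one of the \<open>M\<close> orbits. As these are far apart and one step
  of \<open>f\<close> cannot change the distances much, it is always the orbit of \<open>z i\<close>.\<close>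

lemma equicontinuous_maximal_class:
  assumes M: "class_with_points M" "\<not> class_with_points (Suc M)"
  shows "\<exists>a' z. (\<forall>w. (a', w) \<in> chain_rel f \<longrightarrow> (\<exists>i<M. w = z i)) \<and>
    (\<forall>\<epsilon>>0. \<exists>\<beta>>0. \<forall>i<M. \<forall>y. dist y (z i) < \<beta> \<longrightarrow>
      (\<forall>k. dist ((f ^^ k) y) ((f ^^ k) (z i)) < \<epsilon>))"
proof -
  obtain a' a where a: "inj_on a {..<M}" "\<And>i. i \<in> {..<M} \<Longrightarrow> (a', a i) \<in> chain_rel f"
    using M(1) by (auto simp: class_with_points_def)
  obtain c z where c: "0 < c" and z: "\<And>i. i \<in> {..<M} \<Longrightarrow> (a', z i) \<in> chain_rel f"
    and sep: "\<And>i j k. i \<in> {..<M} \<Longrightarrow> j \<in> {..<M} \<Longrightarrow> i \<noteq> j \<Longrightarrow>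
      c \<le> dist ((f ^^ k) (z i)) ((f ^^ k) (z j))"
    using uniformly_separated_orbits_in_class[OF finite_lessThan a] by metis
  have exhaust: "\<exists>i<M. w = (f ^^ k) (z i)" if w: "((f ^^ k) a', w) \<in> chain_rel f" for w k
  proof (rule ccontr)
    assume new: "\<not> (\<exists>i<M. w = (f ^^ k) (z i))"
    \<comment> \<open>Together with the images of the \<open>z i\<close>, the point \<open>w\<close> gives \<open>M + 1\<close> points in one class.\<close>
    define b where "b = (\<lambda>i. if i < M then (f ^^ k) (z i) else w)"
    have "(f ^^ k) (z i) \<noteq> (f ^^ k) (z j)" if "i < M" "j < M" "i \<noteq> j" for i j
      using sep[of i j k] c that by auto
    then have "inj_on b {..<Suc M}"
      using new by (auto simp: inj_on_def b_def less_Suc_eq)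
    moreover have "((f ^^ k) a', b i) \<in> chain_rel f" if "i < Suc M" for i
      using w z[of i] chain_rel_funpow by (auto simp: b_def)
    ultimately show False using M(2) by (auto simp: class_with_points_def)
  qed
  have "\<exists>\<beta>>0. \<forall>i<M. \<forall>y. dist y (z i) < \<beta> \<longrightarrow> (\<forall>k. dist ((f ^^ k) y) ((f ^^ k) (z i)) < \<epsilon>)"
    if "0 < \<epsilon>" for \<epsilon>
  proof -
    obtain \<omega> where \<omega>: "0 < \<omega>" "\<And>u v. dist u v < \<omega> \<Longrightarrow> dist (f u) (f v) < c / 3"
    proof -
      obtain d where "0 < d" "\<forall>r\<le>1. \<forall>u v. dist u v < d \<longrightarrow> dist ((f ^^ r) u) ((f ^^ r) v) < c / 3"
        using uniformly_continuous_funpow[of "c / 3" 1] c by auto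
      then show thesis using that[of d] by force
    qed
    define \<gamma> where "\<gamma> = Min {\<omega>, c / 3, \<epsilon>}"
    have \<gamma>: "0 < \<gamma>" "\<gamma> \<le> \<omega>" "\<gamma> \<le> c / 3" "\<gamma> \<le> \<epsilon>" using \<omega> c \<open>0 < \<epsilon>\<close> by (auto simp: \<gamma>_def)
    obtain \<beta> where \<beta>: "0 < \<beta>"
      "\<And>x y. (x, y) \<in> chain_rel_delta f \<beta> \<Longrightarrow> \<exists>y'. (x, y') \<in> chain_rel f \<and> dist y y' < \<gamma>"
      using chain_rel_delta_near_class[OF \<gamma>(1)] by blast
    have "dist ((f ^^ k) y) ((f ^^ k) (z i)) < \<gamma>"
      if i: "i < M" and y: "dist y (z i) < min (\<beta> / 2) \<gamma>" for i y k
    proof (induction k)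
      case 0
      then show ?case using y by simp
    next
      case (Suc k)
      have "(z i, y) \<in> chain_rel_delta f \<beta>"
        using chain_rel_delta_if_close[OF \<beta>(1)] y by (simp add: dist_commute)
      then have "((f ^^ Suc k) (z i), (f ^^ Suc k) y) \<in> chain_rel_delta f \<beta>"
        using chain_rel_delta_step[OF \<beta>(1) _ chain_to_orbit chain_to_orbit] \<beta>(1)
        by (meson less_imp_le zero_less_Suc)
      then obtain w where w: "((f ^^ Suc k) (z i), w) \<in> chain_rel f" "dist ((f ^^ Suc k) y) w < \<gamma>"
        using \<beta>(2) by blast
      have "((f ^^ Suc k) a', w) \<in> chain_rel f"
        using chain_rel_trans[OF chain_rel_funpow w(1)] z i by blast
      then obtain j where j: "j < M" "w = (f ^^ Suc k) (z j)" using exhaust by blast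
      have "dist ((f ^^ Suc k) y) ((f ^^ Suc k) (z i)) < c / 3"
        using \<omega>(2) Suc.IH \<gamma>(2) by simp
      then have "dist ((f ^^ Suc k) (z i)) ((f ^^ Suc k) (z j)) < c"
        using w(2) \<gamma>(3) c dist_triangle[of "(f ^^ Suc k) (z i)" "(f ^^ Suc k) (z j)" "(f ^^ Suc k) y"]
        unfolding j(2) dist_commute[of "(f ^^ Suc k) (z i)" "(f ^^ Suc k) y"] by linarith
      then have "i = j" using sep[of i j "Suc k"] i j(1) by force
      then show ?case using w(2) j(2) by simp
    qed
    then have "\<forall>i<M. \<forall>y. dist y (z i) < min (\<beta> / 2) \<gamma> \<longrightarrow>
        (\<forall>k. dist ((f ^^ k) y) ((f ^^ k) (z i)) < \<epsilon>)"
      using \<gamma>(4) by (meson less_le_trans)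
    moreover have "0 < min (\<beta> / 2) \<gamma>" using \<beta>(1) \<gamma>(1) by simp
    ultimately show ?thesis by blast
  qed
  moreover have "\<exists>i<M. w = z i" if "(a', w) \<in> chain_rel f" for w
    using exhaust[of 0 w] that by simp
  ultimately show ?thesis by blast
qed

text \<open>A chain of length \<open>k\<close> from \<open>y\<close> to \<open>a'\<close> shows that \<open>f\<^sup>k(y) \<sim>\<^sub>\<beta> a'\<close>, so every orbit comes close to a
  point of an equicontinuous class and \<open>y\<close> inherits the equicontinuity of that point.\<close>

lemma class_with_points_if_entropy_pos:
  assumes "topological_entropy f > 0"
  shows "class_with_points n"
proof (rule ccontr)
  assume "\<not> class_with_points n"
  moreover have "class_with_points 0" by (simp add: class_with_points_def)
  ultimately obtain M where M: "class_with_points M" "\<not> class_with_points (Suc M)"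
    by (metis nat_induct)
  obtain a' z where exhaust: "\<And>w. (a', w) \<in> chain_rel f \<Longrightarrow> \<exists>i<M. w = z i"
    and equi: "\<And>\<epsilon>. 0 < \<epsilon> \<Longrightarrow> \<exists>\<beta>>0. \<forall>i<M. \<forall>y. dist y (z i) < \<beta> \<longrightarrow>
        (\<forall>k. dist ((f ^^ k) y) ((f ^^ k) (z i)) < \<epsilon>)"
    using equicontinuous_maximal_class[OF M] by blast
  have "\<exists>W. open W \<and> y \<in> W \<and> (\<forall>u\<in>W. \<forall>v\<in>W. \<forall>j. dist ((f ^^ j) u) ((f ^^ j) v) \<le> \<epsilon>)"
    if "0 < \<epsilon>" for \<epsilon> y
  proof -
    have "0 < \<epsilon> / 2" using that by simp
    obtain \<gamma> where \<gamma>: "0 < \<gamma>" "\<forall>i<M. \<forall>y. dist y (z i) < \<gamma> \<longrightarrow>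
        (\<forall>k. dist ((f ^^ k) y) ((f ^^ k) (z i)) < \<epsilon> / 2)"
      using equi[OF \<open>0 < \<epsilon> / 2\<close>] by blast
    obtain \<beta> where \<beta>: "0 < \<beta>"
      "\<And>x y. (x, y) \<in> chain_rel_delta f \<beta> \<Longrightarrow> \<exists>y'. (x, y') \<in> chain_rel f \<and> dist y y' < \<gamma>"
      using chain_rel_delta_near_class[OF \<gamma>(1)] by blast
    obtain k where k: "chain_to f \<beta> k y a'" using chain_to_exists[OF \<beta>(1)] by blast
    have "(a', (f ^^ k) y) \<in> chain_rel_delta f \<beta>"
      using chain_rel_delta_step[OF \<beta>(1) chain_rel_delta_refl[OF \<beta>(1)] k chain_to_orbit]
        chain_to_length_pos[OF k] \<beta>(1) by simp
    then obtain i where i: "i < M" "dist ((f ^^ k) y) (z i) < \<gamma>" using \<beta>(2) exhaust by blast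
    obtain d where d: "0 < d"
      "\<And>j u v. j \<le> k \<Longrightarrow> dist u v < d \<Longrightarrow> dist ((f ^^ j) u) ((f ^^ j) v) < \<epsilon> / 2"
      using uniformly_continuous_funpow[OF \<open>0 < \<epsilon> / 2\<close>, of k] by blast
    define W where "W = (f ^^ k) -` ball (z i) \<gamma> \<inter> ball y d"
    have "dist ((f ^^ j) u) ((f ^^ j) v) \<le> \<epsilon>" if uv: "u \<in> W" "v \<in> W" for u v j
    proof -
      have "\<exists>p. dist ((f ^^ j) w) p < \<epsilon> / 2 \<and> dist ((f ^^ j) w') p < \<epsilon> / 2"
        if "w \<in> W" "w' \<in> W" for w w'
      proof (cases "j \<le> k")
        case True
        then have "dist ((f ^^ j) w) ((f ^^ j) y) < \<epsilon> / 2" "dist ((f ^^ j) w') ((f ^^ j) y) < \<epsilon> / 2"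
          using d(2) that by (auto simp: W_def dist_commute)
        then show ?thesis by blast
      next
        case False
        then have "(f ^^ j) x = (f ^^ (j - k)) ((f ^^ k) x)" for x
          by (metis comp_apply funpow_add le_add_diff_inverse2 nat_le_linear)
        moreover have "dist ((f ^^ k) w) (z i) < \<gamma>" "dist ((f ^^ k) w') (z i) < \<gamma>"
          using that by (auto simp: W_def dist_commute)
        ultimately have "dist ((f ^^ j) w) ((f ^^ (j - k)) (z i)) < \<epsilon> / 2"
          "dist ((f ^^ j) w') ((f ^^ (j - k)) (z i)) < \<epsilon> / 2"
          using \<gamma>(2)[rule_format, OF i(1)] by simp_all
        then show ?thesis by blast
      qed
      then obtain p where p: "dist ((f ^^ j) u) p < \<epsilon> / 2" "dist ((f ^^ j) v) p < \<epsilon> / 2"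
        using uv by blast
      then show ?thesis
        using dist_triangle2[of "(f ^^ j) u" "(f ^^ j) v" p] by linarith
    qed
    moreover have "open W"
      unfolding W_def using continuous_funpow[of k]
      by (intro open_Int open_ball open_vimage)
    moreover have "y \<in> W" using i(2) d(1) by (simp add: W_def dist_commute)
    ultimately show ?thesis by blast
  qed
  then have "topological_entropy f \<le> 0"
    by (rule topological_entropy_nonpos[OF compact_space])
  then show False using assms by simp
qed

end

section \<open>Sets of upper density one and category\<close>

lemma upper_density_le_1: "upper_density A \<le> 1"
proof -
  have "card {k. k < m \<and> k \<in> A} \<le> m" for m
    using card_mono[of "{..<m}" "{k. k < m \<and> k \<in> A}"] by auto
  then show ?thesis
    unfolding upper_density_def
    by (intro Limsup_bounded always_eventually) (auto simp: divide_le_eq)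
qed

lemma upper_density_eq_1:
  assumes "\<And>N. \<exists>m>N. real (card {k. k < m \<and> k \<in> A}) > (1 - 1 / real (Suc N)) * real m"
  shows "upper_density A = 1"
proof (rule antisym)
  show "upper_density A \<le> 1" by (rule upper_density_le_1)
  show "1 \<le> upper_density A"
  proof (rule ccontr)
    assume "\<not> 1 \<le> upper_density A"
    then obtain r where r: "upper_density A < ereal r" "ereal r < 1"
      using ereal_dense2[of "upper_density A" 1] by (meson not_le)
    then have "\<forall>\<^sub>F m in sequentially. ereal (real (card {k. k < m \<and> k \<in> A}) / real m) < ereal r"
      unfolding upper_density_def by (intro Limsup_lessD)
    then obtain N where N: "\<And>m. N \<le> m \<Longrightarrow> real (card {k. k < m \<and> k \<in> A}) / real m < r"
      by (auto simp: eventually_sequentially)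
    obtain N' where N': "inverse (real (Suc N')) < 1 - r"
      using reals_Archimedean[of "1 - r"] r(2) by auto
    define M where "M = max N N'"
    obtain m where m: "m > M" "real (card {k. k < m \<and> k \<in> A}) > (1 - 1 / real (Suc M)) * real m"
      using assms by blast
    have "1 / real (Suc M) \<le> inverse (real (Suc N'))"
      by (simp add: M_def field_simps)
    then have "r < 1 - 1 / real (Suc M)" using N' by linarith
    then have "r * real m < (1 - 1 / real (Suc M)) * real m"
      using m(1) by (intro mult_strict_right_mono) auto
    then have "r * real m < real (card {k. k < m \<and> k \<in> A})" using m(2) by linarith
    moreover have "real (card {k. k < m \<and> k \<in> A}) < r * real m"
      using N[of m] m(1) by (simp add: M_def pos_divide_less_eq)
    ultimately show False by simp
  qed
qed

lemma upper_density_mono_1: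
  assumes "A \<subseteq> B" "upper_density A = 1"
  shows "upper_density B = 1"
proof (rule antisym)
  have "card {k. k < m \<and> k \<in> A} \<le> card {k. k < m \<and> k \<in> B}" for m
    using assms(1) by (intro card_mono) auto
  then have "upper_density A \<le> upper_density B"
    unfolding upper_density_def
    by (intro Limsup_mono always_eventually) (auto intro!: divide_right_mono)
  then show "1 \<le> upper_density B" using assms(2) by simp
  show "upper_density B \<le> 1" by (rule upper_density_le_1)
qed

lemma residual_in_mono:
  assumes "residual_in T S" "S \<subseteq> S'" "S' \<subseteq> topspace T"
  shows "residual_in T S'"
proof -
  obtain G where "gdelta_in T G" "T closure_of G = topspace T" "G \<subseteq> S"
    using assms(1) by (auto simp: residual_in_def)
  moreover have "G \<subseteq> S'" using calculation(3) assms(2) by (rule subset_trans)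
  ultimately show ?thesis using assms(3) unfolding residual_in_def by metis
qed

text \<open>Having \<open>k\<close> in the set for more than a given share of the \<open>k < m\<close>, for some \<open>m > N\<close>, is an open
  condition, and a point that is eventually in \<open>Q j k\<close> satisfies it for all shares and all \<open>N\<close>. So
  the set in question contains a countable intersection of dense open sets.\<close>

lemma residual_upper_density_eq_1:
  fixes Q :: "nat \<Rightarrow> nat \<Rightarrow> 'b set"
  assumes T: "compact_space T" "Hausdorff_space T"
    and opn: "\<And>j k. openin T (Q j k)"
    and dense: "\<And>j U. openin T U \<Longrightarrow> U \<noteq> {} \<Longrightarrow> \<exists>y\<in>U. \<exists>L. \<forall>k\<ge>L. y \<in> Q j k"
  shows "residual_in T {x \<in> topspace T. \<forall>j. upper_density {k. x \<in> Q j k} = 1}"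
proof -
  define R where "R = (\<lambda>j N m. {x \<in> topspace T.
      real (card {k. k < m \<and> x \<in> Q j k}) > (1 - 1 / real (Suc N)) * real m})"
  define V where "V = (\<lambda>(j, N). \<Union>m\<in>{N<..}. R j N m)"
  have openR: "openin T (R j N m)" for j N m
  proof (subst openin_subopen, intro ballI)
    fix x assume x: "x \<in> R j N m"
    define K where "K = {k. k < m \<and> x \<in> Q j k}"
    have K: "finite K" by (simp add: K_def)
    have "(\<Inter>k\<in>K. Q j k) \<inter> topspace T \<subseteq> R j N m"
    proof
      fix y assume y: "y \<in> (\<Inter>k\<in>K. Q j k) \<inter> topspace T"
      then have "K \<subseteq> {k. k < m \<and> y \<in> Q j k}" by (auto simp: K_def)
      then have "card K \<le> card {k. k < m \<and> y \<in> Q j k}" by (intro card_mono) auto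
      then show "y \<in> R j N m" using x y by (auto simp: R_def K_def)
    qed
    moreover have "x \<in> (\<Inter>k\<in>K. Q j k) \<inter> topspace T" using x by (auto simp: K_def R_def)
    moreover have "openin T ((\<Inter>k\<in>K. Q j k) \<inter> topspace T)" using K opn by blast
    ultimately show "\<exists>W. openin T W \<and> x \<in> W \<and> W \<subseteq> R j N m" by blast
  qed
  then have openV: "openin T (V p)" for p
    by (cases p) (auto simp: V_def)
  have denseV: "T closure_of (V p) = topspace T" for p
    unfolding dense_intersects_open
  proof (intro allI impI, elim conjE)
    fix U assume U: "openin T U" "U \<noteq> {}"
    obtain j N where p: "p = (j, N)" by (cases p)
    obtain y L where y: "y \<in> U" "\<And>k. L \<le> k \<Longrightarrow> y \<in> Q j k" using dense[OF U, of j] by blast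
    \<comment> \<open>The first \<open>L\<close> times are less than the share \<open>1 / (N + 1)\<close> of all times below this \<open>m\<close>.\<close>
    define m where "m = Suc L * Suc N"
    have "N < m" "L \<le> m" by (simp_all add: m_def)
    have "{L..<m} \<subseteq> {k. k < m \<and> y \<in> Q j k}" using y(2) by auto
    then have "m - L \<le> card {k. k < m \<and> y \<in> Q j k}"
      using card_mono[of "{k. k < m \<and> y \<in> Q j k}" "{L..<m}"] by simp
    moreover have "(1 - 1 / real (Suc N)) * real m < real (m - L)"
    proof -
      have "real m / real (Suc N) = real (Suc L)" by (simp add: m_def field_simps)
      then show ?thesis using \<open>L \<le> m\<close> by (simp add: algebra_simps of_nat_diff)
    qed
    ultimately have "y \<in> R j N m"
      using y(1) openin_subset[OF U(1)] by (auto simp: R_def)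
    then show "V p \<inter> U \<noteq> {}" using y(1) \<open>N < m\<close> by (auto simp: V_def p)
  qed
  have "T closure_of (\<Inter>(range V)) = topspace T"
    using T openV denseV
    by (intro Baire_category)
      (auto simp: compact_imp_locally_compact_space compact_Hausdorff_imp_regular_space)
  moreover have "gdelta_in T (\<Inter>(range V))"
    using openV by (intro gdelta_in_Inter) (auto intro: open_imp_gdelta_in)
  moreover have "\<Inter>(range V) \<subseteq> {x \<in> topspace T. \<forall>j. upper_density {k. x \<in> Q j k} = 1}"
  proof
    fix x assume x: "x \<in> \<Inter>(range V)"
    have "\<exists>m>N. x \<in> R j N m" for j N
    proof -
      have "x \<in> V (j, N)" using x by blast
      then show ?thesis by (auto simp: V_def)
    qed
    then have "upper_density {k. x \<in> Q j k} = 1" for j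
      by (intro upper_density_eq_1) (auto simp: R_def)
    moreover have "x \<in> V (0, 0)" using x by blast
    then have "x \<in> topspace T" by (auto simp: V_def R_def)
    ultimately show "x \<in> {x \<in> topspace T. \<forall>j. upper_density {k. x \<in> Q j k} = 1}" by simp
  qed
  ultimately show ?thesis unfolding residual_in_def by blast
qed

lemma box_in_open_product:
  fixes D :: "'a::metric_space set"
  assumes "openin (product_topology (\<lambda>_. top_of_set D) I) U" "x \<in> U" "finite I"
  shows "\<exists>\<eta>>0. \<forall>y. y \<in> I \<rightarrow>\<^sub>E D \<longrightarrow> (\<forall>i\<in>I. dist (y i) (x i) < \<eta>) \<longrightarrow> y \<in> U"
proof -
  obtain B where B: "\<And>i. i \<in> I \<Longrightarrow> openin (top_of_set D) (B i)" "x \<in> Pi\<^sub>E I B" "Pi\<^sub>E I B \<subseteq> U"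
    using assms(1,2) unfolding openin_product_topology_alt by meson
  have "\<exists>e>0. \<forall>u\<in>D. dist u (x i) < e \<longrightarrow> u \<in> B i" if "i \<in> I" for i
  proof -
    have "x i \<in> B i" using B(2) that by auto
    then show ?thesis using B(1)[OF that] by (auto simp: openin_euclidean_subtopology_iff)
  qed
  then obtain e where e: "\<And>i. i \<in> I \<Longrightarrow> 0 < e i"
    "\<And>i u. i \<in> I \<Longrightarrow> u \<in> D \<Longrightarrow> dist u (x i) < e i \<Longrightarrow> u \<in> B i"
    by metis
  define \<eta> where "\<eta> = Min (insert 1 (e ` I))"
  have "0 < \<eta>" using assms(3) e(1) by (simp add: \<eta>_def)
  moreover have "\<eta> \<le> e i" if "i \<in> I" for i using assms(3) that by (simp add: \<eta>_def)
  then have "y \<in> U" if y: "y \<in> I \<rightarrow>\<^sub>E D" "\<And>i. i \<in> I \<Longrightarrow> dist (y i) (x i) < \<eta>" for y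
  proof -
    have "y i \<in> B i" if "i \<in> I" for i
      using e(2)[OF that] y(1) y(2)[OF that] \<open>\<And>i. i \<in> I \<Longrightarrow> \<eta> \<le> e i\<close>[OF that] that
      by (auto simp: PiE_iff)
    then have "y \<in> Pi\<^sub>E I B" using y(1) by (simp add: PiE_iff)
    then show ?thesis using B(3) by blast
  qed
  ultimately show ?thesis by blast
qed

lemma openin_product_dist:
  fixes f :: "'a::metric_space \<Rightarrow> 'a"
  assumes f: "continuous_on UNIV (f ^^ k)" and "i \<in> I" "j \<in> I" "open S"
  shows "openin (product_topology (\<lambda>_. top_of_set D) I)
    {x \<in> I \<rightarrow>\<^sub>E D. dist ((f ^^ k) (x i)) ((f ^^ k) (x j)) \<in> S}"
proof -
  let ?T = "product_topology (\<lambda>_. top_of_set D) I"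
  have "continuous_map ?T euclidean (\<lambda>x. x l)" if "l \<in> I" for l
    using continuous_map_product_projection[OF that, of "\<lambda>_. top_of_set D"]
    by (simp add: continuous_map_in_subtopology)
  moreover have "continuous_map euclidean euclidean (f ^^ k)" using f by simp
  ultimately have "continuous_map ?T euclidean (\<lambda>x. (f ^^ k) (x l))" if "l \<in> I" for l
    using that continuous_map_compose[of ?T euclidean "\<lambda>x. x l" euclidean "f ^^ k"] by (simp add: o_def)
  then have "continuous_map ?T (prod_topology euclidean euclidean) (\<lambda>x. ((f ^^ k) (x i), (f ^^ k) (x j)))"
    using assms(2,3) by (intro continuous_map_pairedI) auto
  moreover have "open ((\<lambda>p :: 'a \<times> 'a. dist (fst p) (snd p)) -` S)"
    using assms(4) by (intro open_vimage continuous_intros)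
  ultimately show ?thesis
    using openin_continuous_map_preimage[of ?T euclidean
        "\<lambda>x. ((f ^^ k) (x i), (f ^^ k) (x j))" "(\<lambda>p. dist (fst p) (snd p)) -` S"]
    by simp
qed

section \<open>Distributional chaos\<close>

context class_shadowing_map
begin

text \<open>The targets \<open>z i\<close> may lie in a class other than \<open>D\<close>; this is why one scrambling constant serves all
  classes.\<close>

lemma eventual_behaviour_dense:
  assumes D: "D = chain_rel f `` {d}" and "finite I" "0 < \<epsilon>"
    and U: "openin (product_topology (\<lambda>_. top_of_set D) I) U" "U \<noteq> {}"
    and z: "\<And>i. i \<in> I \<Longrightarrow> (z', z i) \<in> chain_rel f"
  shows "\<exists>y\<in>U. y \<in> I \<rightarrow>\<^sub>E D \<and>
    (\<exists>L. \<forall>k\<ge>L. \<forall>i\<in>I. dist ((f ^^ k) (y i)) ((f ^^ (k - L)) (z i)) \<le> \<epsilon>)"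
proof -
  obtain x where x: "x \<in> U" using U(2) by blast
  have xD: "x \<in> I \<rightarrow>\<^sub>E D" using openin_subset[OF U(1)] x by auto
  obtain \<eta> where \<eta>: "0 < \<eta>"
    "\<forall>y. y \<in> I \<rightarrow>\<^sub>E D \<longrightarrow> (\<forall>i\<in>I. dist (y i) (x i) < \<eta>) \<longrightarrow> y \<in> U"
    using box_in_open_product[OF U(1) x assms(2)] by blast
  define e where "e = min \<epsilon> (\<eta> / 2)"
  have e: "0 < e" "e \<le> \<epsilon>" "e < \<eta>" using \<eta>(1) \<open>0 < \<epsilon>\<close> by (auto simp: e_def)
  have xd: "(x i, d) \<in> chain_rel f" if "i \<in> I" for i
    using xD D that chain_rel_sym by auto
  obtain L y where y: "\<And>i. i \<in> I \<Longrightarrow> (x i, y i) \<in> chain_rel f" "\<And>i. i \<in> I \<Longrightarrow> dist (y i) (x i) \<le> e"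
    "\<And>i k. i \<in> I \<Longrightarrow> L \<le> k \<Longrightarrow> dist ((f ^^ k) (y i)) ((f ^^ (k - L)) (z i)) \<le> e"
    using simultaneous_tracing[where x = x and z = z, OF e(1) assms(2) xd z] by blast
  define w where "w = restrict y I"
  have "(d, y i) \<in> chain_rel f" if "i \<in> I" for i
    using chain_rel_trans[OF chain_rel_sym[OF xd[OF that]] y(1)[OF that]] .
  then have "w \<in> I \<rightarrow>\<^sub>E D" by (auto simp: w_def D)
  moreover have "w \<in> U"
    using \<eta>(2)[rule_format, OF \<open>w \<in> I \<rightarrow>\<^sub>E D\<close>] y(2) e(3) by (force simp: w_def)
  moreover have "dist ((f ^^ k) (w i)) ((f ^^ (k - L)) (z i)) \<le> \<epsilon>" if "i \<in> I" "L \<le> k" for i k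
    using y(3)[OF that] e(2) that by (simp add: w_def)
  ultimately show ?thesis by blast
qed

text \<open>Tuples that trace the separated orbits of the \<open>z i\<close>, and tuples that trace the single orbit of \<open>z'\<close>,
  are both dense.\<close>

lemma DC1_residual:
  assumes "2 \<le> n" "0 < c"
    and z: "\<And>i. i \<in> {1..n} \<Longrightarrow> (z', z i) \<in> chain_rel f"
    and sep: "\<And>i j k. i \<in> {1..n} \<Longrightarrow> j \<in> {1..n} \<Longrightarrow> i \<noteq> j \<Longrightarrow>
      c \<le> dist ((f ^^ k) (z i)) ((f ^^ k) (z j))"
    and "D \<in> chain_classes f"
  shows "residual_in (product_topology (\<lambda>_. top_of_set D) {1..n}) (({1..n} \<rightarrow>\<^sub>E D) \<inter> DC1 n (c / 2) f)"
proof -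
  define I where "I = {1..n}"
  define T where "T = product_topology (\<lambda>_. top_of_set D) I"
  obtain d where D: "D = chain_rel f `` {d}"
    using assms(5) by (auto simp: chain_classes_def elim: quotientE)
  have fin: "finite I" by (simp add: I_def)
  have topT: "topspace T = I \<rightarrow>\<^sub>E D" by (simp add: T_def)
  have "compact D"
    using closed_chain_rel_class[of d] compact_space compact_Int_closed[of UNIV D] by (simp add: D)
  then have T: "compact_space T" "Hausdorff_space T"
    unfolding T_def compact_space_product_topology Hausdorff_space_product_topology
    by (auto simp: Hausdorff_space_subtopology compact_space_subtopology)
  define J where "J = {(i, j). 1 \<le> i \<and> i < j \<and> j \<le> n}"
  have J: "finite J" "J \<noteq> {}" "\<And>i j. (i, j) \<in> J \<Longrightarrow> i \<in> I \<and> j \<in> I \<and> i \<noteq> j"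
  proof -
    show "finite J" by (rule finite_subset[of _ "{1..n} \<times> {1..n}"]) (auto simp: J_def)
    have "(1, 2) \<in> J" using assms(1) by (simp add: J_def)
    then show "J \<noteq> {}" by blast
  qed (auto simp: J_def I_def)
  have pd: "pair_dists f n x k = (\<lambda>(i, j). dist ((f ^^ k) (x i)) ((f ^^ k) (x j))) ` J" for x k
    by (auto simp: pair_dists_def J_def image_iff)
  \<comment> \<open>\<open>S 0\<close> encodes separation by more than \<open>c / 2\<close>, \<open>S (Suc l)\<close> proximality up to \<open>1 / (l + 1)\<close>.\<close>
  define S where "S = (\<lambda>l. case l of 0 \<Rightarrow> {c / 2<..} | Suc l \<Rightarrow> {..<inverse (real (Suc l))})"
  define Q where "Q = (\<lambda>l k. (\<Inter>(i, j)\<in>J. {x \<in> I \<rightarrow>\<^sub>E D. dist ((f ^^ k) (x i)) ((f ^^ k) (x j)) \<in> S l})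
      \<inter> topspace T)"
  have "open (S l)" for l by (cases l) (auto simp: S_def)
  then have opn: "openin T (Q l k)" for l k
    unfolding Q_def T_def using J(1,3)
    by (intro openin_INT) (auto intro!: openin_product_dist continuous_funpow)
  have dense: "\<exists>y\<in>U. \<exists>L. \<forall>k\<ge>L. y \<in> Q l k" if U: "openin T U" "U \<noteq> {}" for l U
  proof -
    have "\<exists>\<epsilon>>0. \<exists>w. (\<forall>i\<in>I. (z', w i) \<in> chain_rel f) \<and> (\<forall>(i, j)\<in>J. \<forall>k u v.
        dist u ((f ^^ k) (w i)) \<le> \<epsilon> \<longrightarrow> dist v ((f ^^ k) (w j)) \<le> \<epsilon> \<longrightarrow> dist u v \<in> S l)"
    proof (cases l)
      case 0
      have "dist u v \<in> S l"
        if ij: "(i, j) \<in> J" and uv: "dist u ((f ^^ k) (z i)) \<le> c / 5" "dist v ((f ^^ k) (z j)) \<le> c / 5"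
        for i j k u v
      proof -
        have "c \<le> dist ((f ^^ k) (z i)) ((f ^^ k) (z j))"
          using sep J(3)[OF ij] by (simp add: I_def)
        also have "\<dots> \<le> dist u ((f ^^ k) (z i)) + dist u v + dist v ((f ^^ k) (z j))"
          using dist_triangle[of "(f ^^ k) (z i)" "(f ^^ k) (z j)" u] dist_triangle[of u "(f ^^ k) (z j)" v]
          by (simp add: dist_commute)
        finally have "c / 2 < dist u v" using uv assms(2) by linarith
        then show ?thesis by (simp add: S_def 0)
      qed
      then show ?thesis using z assms(2) by (intro exI[of _ "c / 5"] conjI exI[of _ z]) (auto simp: I_def)
    next
      case (Suc l')
      define \<epsilon> where "\<epsilon> = inverse (real (Suc l')) / 3"
      have "0 < \<epsilon>" by (simp add: \<epsilon>_def)
      have "dist u v \<in> S l" if "dist u p \<le> \<epsilon>" "dist v p \<le> \<epsilon>" for u v p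
      proof -
        have "dist u v \<le> 2 * \<epsilon>" using that dist_triangle2[of u v p] by simp
        also have "\<dots> < 3 * \<epsilon>" using \<open>0 < \<epsilon>\<close> by simp
        finally show ?thesis by (simp add: S_def Suc \<epsilon>_def)
      qed
      then show ?thesis using \<open>0 < \<epsilon>\<close> by (intro exI[of _ \<epsilon>] conjI exI[of _ "\<lambda>_. z'"]) auto
    qed
    then obtain \<epsilon> w where "0 < \<epsilon>" and w: "\<And>i. i \<in> I \<Longrightarrow> (z', w i) \<in> chain_rel f"
      and close: "\<And>i j k u v. (i, j) \<in> J \<Longrightarrow> dist u ((f ^^ k) (w i)) \<le> \<epsilon> \<Longrightarrow>
        dist v ((f ^^ k) (w j)) \<le> \<epsilon> \<Longrightarrow> dist u v \<in> S l"
      by fast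
    obtain y L where y: "y \<in> U" "y \<in> I \<rightarrow>\<^sub>E D"
      "\<And>k i. L \<le> k \<Longrightarrow> i \<in> I \<Longrightarrow> dist ((f ^^ k) (y i)) ((f ^^ (k - L)) (w i)) \<le> \<epsilon>"
      using eventual_behaviour_dense[where z = w, OF D fin \<open>0 < \<epsilon>\<close> U[unfolded T_def] w] by blast
    have "y \<in> Q l k" if "L \<le> k" for k
    proof -
      have "dist ((f ^^ k) (y i)) ((f ^^ k) (y j)) \<in> S l" if ij: "(i, j) \<in> J" for i j
        using close[OF ij y(3) y(3)] J(3)[OF ij] \<open>L \<le> k\<close> by simp
      then show ?thesis using y(2) by (auto simp: Q_def topT)
    qed
    then show ?thesis using y(1) by blast
  qed
  have "residual_in T {x \<in> topspace T. \<forall>l. upper_density {k. x \<in> Q l k} = 1}"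
    using T opn dense by (rule residual_upper_density_eq_1)
  moreover have "{x \<in> topspace T. \<forall>l. upper_density {k. x \<in> Q l k} = 1} \<subseteq> (I \<rightarrow>\<^sub>E D) \<inter> DC1 n (c / 2) f"
  proof (intro subsetI, elim CollectE conjE, intro IntI)
    fix x assume "x \<in> topspace T" and dens: "\<forall>l. upper_density {k. x \<in> Q l k} = 1"
    then show x: "x \<in> I \<rightarrow>\<^sub>E D" by (simp add: topT)
    have Q_iff: "x \<in> Q l k \<longleftrightarrow> pair_dists f n x k \<subseteq> S l" for l k
      using x by (auto simp: Q_def topT pd)
    have fin_ne: "finite (pair_dists f n x k)" "pair_dists f n x k \<noteq> {}" for k
      using J by (simp_all add: pd)
    have "upper_density {k. Max (pair_dists f n x k) < \<epsilon>} = 1" if "0 < \<epsilon>" for \<epsilon>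
    proof -
      obtain l where l: "inverse (real (Suc l)) < \<epsilon>" using reals_Archimedean[OF \<open>0 < \<epsilon>\<close>] by blast
      have "{k. x \<in> Q (Suc l) k} \<subseteq> {k. Max (pair_dists f n x k) < \<epsilon>}"
        using l fin_ne by (auto simp: Q_iff S_def)
      then show ?thesis using dens upper_density_mono_1 by metis
    qed
    moreover have "{k. x \<in> Q 0 k} = {k. Min (pair_dists f n x k) > c / 2}"
      using Min_gr_iff[OF fin_ne, of "c / 2"] by (auto simp: Q_iff S_def)
    then have "upper_density {k. Min (pair_dists f n x k) > c / 2} = 1" using dens by metis
    moreover have "x \<in> {1..n} \<rightarrow>\<^sub>E UNIV" using x by (auto simp: I_def PiE_iff)
    ultimately show "x \<in> DC1 n (c / 2) f" by (simp add: DC1_def)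
  qed
  moreover have "(I \<rightarrow>\<^sub>E D) \<inter> DC1 n (c / 2) f \<subseteq> topspace T" by (auto simp: topT)
  ultimately have "residual_in T ((I \<rightarrow>\<^sub>E D) \<inter> DC1 n (c / 2) f)"
    by (rule residual_in_mono)
  then show ?thesis by (simp add: T_def I_def)
qed

end

theorem theorem1p1:
  fixes f :: "'a::metric_space \<Rightarrow> 'a"
  assumes "compact (UNIV :: 'a set)"
    and "continuous_on UNIV f"
    and "chain_transitive f"
    and "shadowing_along_classes f"
    and "continuous_map euclidean (Metric_space.mtopology hyperspace hausdorff_dist) (chain_class f)"
    and "topological_entropy f > 0"
  shows "\<forall>n\<ge>2. \<exists>\<delta>>0. \<forall>D \<in> chain_classes f.
           residual_in (product_topology (\<lambda>_. top_of_set D) {1..n})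
             (({1..n} \<rightarrow>\<^sub>E D) \<inter> DC1 n \<delta> f)"
proof (intro allI impI)
  fix n :: nat assume n: "2 \<le> n"
  interpret class_shadowing_map f
    by unfold_locales (fact assms)+
  obtain a' a where a: "inj_on a {..<Suc n}" "\<And>i. i < Suc n \<Longrightarrow> (a', a i) \<in> chain_rel f"
    using class_with_points_if_entropy_pos[OF assms(6), of "Suc n"] by (auto simp: class_with_points_def)
  have "inj_on a {1..n}" using a(1) by (rule inj_on_subset) auto
  moreover have "(a', a i) \<in> chain_rel f" if "i \<in> {1..n}" for i using a(2) that by simp
  ultimately obtain c z where c: "0 < c" and z: "\<And>i. i \<in> {1..n} \<Longrightarrow> (a', z i) \<in> chain_rel f"
    and sep: "\<And>i j k. i \<in> {1..n} \<Longrightarrow> j \<in> {1..n} \<Longrightarrow> i \<noteq> j \<Longrightarrow>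
      c \<le> dist ((f ^^ k) (z i)) ((f ^^ k) (z j))"
    by (rule uniformly_separated_orbits_in_class[OF finite_atLeastAtMost, of a 1 n a']) blast+
  have "\<forall>D\<in>chain_classes f. residual_in (product_topology (\<lambda>_. top_of_set D) {1..n})
      (({1..n} \<rightarrow>\<^sub>E D) \<inter> DC1 n (c / 2) f)"
    using DC1_residual[where z = z, OF n c z sep] by blast
  then show "\<exists>\<delta>>0. \<forall>D\<in>chain_classes f. residual_in (product_topology (\<lambda>_. top_of_set D) {1..n})
      (({1..n} \<rightarrow>\<^sub>E D) \<inter> DC1 n \<delta> f)"
    using c by (intro exI[of _ "c / 2"]) simp
qed

end
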